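(* Let $\Gamma$ be a recursive game with symmetric signals. Then for every $\pi\in\Delta^*(K\times C\times D)$, the game $\Gamma(\pi)$ has a uniform value.
   Context: A repeated game $\Gamma=(K,I,J,C,D,g,q)$ is given by a finite state space $K$, finite action spaces $I,J$ (players 1, 2), finite signal spaces $C,D$ (players 1, 2), a payoff function $g:K\times I\times J\to[-1,1]$ and a transition function $q:K\times I\times J\to\Delta(K\times C\times D)$. Given an initial distribution $\pi\in\Delta(K\times C\times D)$, the game $\Gamma(\pi)$ is played as follows: $(k_1,c_1,d_1)$ is drawn from $\pi$; at each stage $t\ge1$, player 1 learns $c_t$ and player 2 learns $d_t$, they simultaneously choose $i_t\in I$, $j_t\in J$, the stage payoff is $g(k_t,i_t,j_t)$, and $(k_{t+1},c_{t+1},d_{t+1})$ is drawn from $q(k_t,i_t,j_t)$. Each player's signal contains his own action: there are maps $\hat\imath:C\to I$, $\hat\jmath:D\to J$ such that $q(k,i,j)(k',c,d)>0$ implies $\hat\imath(c)=i$, $\hat\jmath(d)=j$. $\Gamma$ is recursive (a "recursive game with signals") if there is a partition $K=K^0\cup K^*$ with $g(k,i,j)=0$ for all $(k,i,j)\in K^0\times I\times J$, and for all $k\in K^*$ and $(i,j)\in I\times J$: $\sum_{c,d}q(k,i,j)(k,c,d)=1$ and $g(k,i,j)$ depends only on $k$. Player 1 is more informed than player 2 if there is a map $\hat d:C\to D$ such that, with $E=\{(k,c,d):\hat d(c)=d\}$, $q(k,i,j)(E)=1$ for all $(k,i,j)$. Player 2 is more informed than player 1 if there is a map $\hat c:D\to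 C$ such that, with $E'=\{(k,c,d):\hat c(d)=c\}$, $q(k,i,j)(E')=1$ for all $(k,i,j)$. $\Gamma$ has symmetric signals if both hold. $\Delta^*(K\times C\times D)$ is the set of symmetric initial distributions, i.e. those $\pi$ with $\pi(E)=\pi(E')=1$. A behavior strategy of player 1 is $\sigma=(\sigma_t)_{t\ge1}$ with $\sigma_t:(C\times I)^{t-1}\times C\to\Delta(I)$, of player 2 $\tau=(\tau_t)_{t\ge1}$ with $\tau_t:(D\times J)^{t-1}\times D\to\Delta(J)$; $\Sigma,\mathcal T$ denote the sets of strategies. $\gamma_n(\pi,\sigma,\tau)$ is the expectation of $\frac1n\sum_{t=1}^ng(k_t,i_t,j_t)$; player 1 maximizes, player 2 minimizes. $\Gamma(\pi)$ has a uniform maxmin $\underline v_\infty(\pi)$ if: (i) player 1 can guarantee it: for all $\varepsilon>0$ there are $\sigma^*\in\Sigma$, $n_0\ge1$ with $\gamma_n(\pi,\sigma^*,\tau)\ge\underline v_\infty(\pi)-\varepsilon$ for all $n\ge n_0$, $\tau\in\mathcal T$; and (ii) player 2 can defend it: for all $\varepsilon>0$ and $\sigma\in\Sigma$ there are $n_0\ge1$, $\tau^*\in\mathcal T$ with $\gamma_n(\pi,\sigma,\tau^* )\le\underline v_\infty(\pi)+\varepsilon$ for all $n\ge n_0$. The uniform minmax $\overline v_\infty(\pi)$ is defined symmetrically (player 2 can guarantee it and player 1 can defend it). $\Gamma(\pi)$ has a uniform value if $\underline v_\infty(\pi)$ and $\overline v_\infty(\pi)$ both exist and are equal. *)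

theory Defs
  imports "HOL-Probability.Probability"
begin

text \<open>
  A finite repeated game with signals \<open>(K, I, J, C, D, g, q)\<close>: the finite sets are the types
  \<open>'k, 'i, 'j, 'c, 'd\<close> of class \<open>finite\<close>, and the game is given by its payoff function
  \<open>g\<close> and its transition function \<open>q\<close>.
\<close>

type_synonym ('k, 'i, 'j) payoff = "'k \<Rightarrow> 'i \<Rightarrow> 'j \<Rightarrow> real"
type_synonym ('k, 'i, 'j, 'c, 'd) transition = "'k \<Rightarrow> 'i \<Rightarrow> 'j \<Rightarrow> ('k \<times> 'c \<times> 'd) pmf"

definition repeated_game ::
  "('k::finite, 'i::finite, 'j::finite) payoff \<Rightarrow>
   ('k, 'i, 'j, 'c::finite, 'd::finite) transition \<Rightarrow> bool" where
  "repeated_game g q \<longleftrightarrow>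
     (\<forall>k i j. g k i j \<in> {-1..1}) \<and>
     (\<exists>(ihat :: 'c \<Rightarrow> 'i) (jhat :: 'd \<Rightarrow> 'j). \<forall>k i j k' c d.
        pmf (q k i j) (k', c, d) > 0 \<longrightarrow> ihat c = i \<and> jhat d = j)"

definition recursive_game ::
  "('k::finite, 'i::finite, 'j::finite) payoff \<Rightarrow>
   ('k, 'i, 'j, 'c::finite, 'd::finite) transition \<Rightarrow> bool" where
  "recursive_game g q \<longleftrightarrow> repeated_game g q \<and>
     (\<exists>K0 Kstar. K0 \<union> Kstar = UNIV \<and> K0 \<inter> Kstar = {} \<and>
        (\<forall>k\<in>K0. \<forall>i j. g k i j = 0) \<and>
        (\<forall>k\<in>Kstar. \<forall>i j. (\<Sum>c\<in>UNIV. \<Sum>d\<in>UNIV. pmf (q k i j) (k, c, d)) = 1) \<and>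
        (\<forall>k\<in>Kstar. \<forall>i j i' j'. g k i j = g k i' j'))"


subsection \<open>Information structure\<close>

text \<open>
  The maps \<open>dhat : C \<rightarrow> D\<close> and \<open>chat : D \<rightarrow> C\<close> are explicit parameters, since the events
  \<open>E\<close> and \<open>E'\<close>, and hence the set of symmetric initial distributions, refer to them.
\<close>

definition event_E :: "('c \<Rightarrow> 'd) \<Rightarrow> ('k \<times> 'c \<times> 'd) set" where
  "event_E dhat = {(k, c, d). dhat c = d}"

definition event_E' :: "('d \<Rightarrow> 'c) \<Rightarrow> ('k \<times> 'c \<times> 'd) set" where
  "event_E' chat = {(k, c, d). chat d = c}"

definition player1_more_informed ::
  "('k, 'i, 'j, 'c, 'd) transition \<Rightarrow> ('c \<Rightarrow> 'd) \<Rightarrow> bool" where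
  "player1_more_informed q dhat \<longleftrightarrow>
     (\<forall>k i j. measure_pmf.prob (q k i j) (event_E dhat) = 1)"

definition player2_more_informed ::
  "('k, 'i, 'j, 'c, 'd) transition \<Rightarrow> ('d \<Rightarrow> 'c) \<Rightarrow> bool" where
  "player2_more_informed q chat \<longleftrightarrow>
     (\<forall>k i j. measure_pmf.prob (q k i j) (event_E' chat) = 1)"

definition symmetric_signals ::
  "('k, 'i, 'j, 'c, 'd) transition \<Rightarrow> ('c \<Rightarrow> 'd) \<Rightarrow> ('d \<Rightarrow> 'c) \<Rightarrow> bool" where
  "symmetric_signals q dhat chat \<longleftrightarrow>
     player1_more_informed q dhat \<and> player2_more_informed q chat"

definition symmetric_initial ::
  "('c \<Rightarrow> 'd) \<Rightarrow> ('d \<Rightarrow> 'c) \<Rightarrow> ('k \<times> 'c \<times> 'd) pmf set" where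
  "symmetric_initial dhat chat =
     {p. measure_pmf.prob p (event_E dhat) = 1 \<and> measure_pmf.prob p (event_E' chat) = 1}"


subsection \<open>Strategies and plays\<close>

text \<open>
  A behavior strategy maps the private history (a list of pairs of signal and action, oldest
  first; its length is \<open>t - 1\<close> at stage \<open>t\<close>) and the current signal to a mixed action.
\<close>

type_synonym ('s, 'a) strategy = "('s \<times> 'a) list \<Rightarrow> 's \<Rightarrow> 'a pmf"

text \<open>
  \<open>play q p \<sigma> \<tau> n\<close> is the joint law of the first \<open>n\<close> stages
  \<open>(k\<^sub>t, c\<^sub>t, d\<^sub>t, i\<^sub>t, j\<^sub>t)\<close>, \<open>1 \<le> t \<le> n\<close>, and of the triple
  \<open>(k, c, d)\<close> with which stage \<open>n + 1\<close> begins.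
\<close>

primrec play ::
  "('k, 'i, 'j, 'c, 'd) transition \<Rightarrow> ('k \<times> 'c \<times> 'd) pmf \<Rightarrow>
   ('c, 'i) strategy \<Rightarrow> ('d, 'j) strategy \<Rightarrow> nat \<Rightarrow>
   (('k \<times> 'c \<times> 'd \<times> 'i \<times> 'j) list \<times> ('k \<times> 'c \<times> 'd)) pmf" where
  "play q p \<sigma> \<tau> 0 = map_pmf (\<lambda>s. ([], s)) p"
| "play q p \<sigma> \<tau> (Suc n) = do {
     (h, (k, c, d)) \<leftarrow> play q p \<sigma> \<tau> n;
     i \<leftarrow> \<sigma> (map (\<lambda>(k, c, d, i, j). (c, i)) h) c;
     j \<leftarrow> \<tau> (map (\<lambda>(k, c, d, i, j). (d, j)) h) d;
     s \<leftarrow> q k i j;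
     return_pmf (h @ [(k, c, d, i, j)], s)
   }"

definition mean_payoff ::
  "('k, 'i, 'j) payoff \<Rightarrow> ('k, 'i, 'j, 'c, 'd) transition \<Rightarrow> nat \<Rightarrow>
   ('k \<times> 'c \<times> 'd) pmf \<Rightarrow> ('c, 'i) strategy \<Rightarrow> ('d, 'j) strategy \<Rightarrow> real" where
  "mean_payoff g q n p \<sigma> \<tau> =
     measure_pmf.expectation (play q p \<sigma> \<tau> n)
       (\<lambda>(h, s). (1 / real n) * (\<Sum>(k, c, d, i, j)\<leftarrow>h. g k i j))"


subsection \<open>Uniform maxmin, minmax and value\<close>

definition is_uniform_maxmin ::
  "('k, 'i, 'j) payoff \<Rightarrow> ('k, 'i, 'j, 'c, 'd) transition \<Rightarrow>
   ('k \<times> 'c \<times> 'd) pmf \<Rightarrow> real \<Rightarrow> bool" where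
  "is_uniform_maxmin g q p v \<longleftrightarrow>
     (\<forall>\<epsilon>>0. \<exists>\<sigma>. \<exists>n0\<ge>1. \<forall>n\<ge>n0. \<forall>\<tau>. mean_payoff g q n p \<sigma> \<tau> \<ge> v - \<epsilon>) \<and>
     (\<forall>\<epsilon>>0. \<forall>\<sigma>. \<exists>n0\<ge>1. \<exists>\<tau>. \<forall>n\<ge>n0. mean_payoff g q n p \<sigma> \<tau> \<le> v + \<epsilon>)"

definition is_uniform_minmax ::
  "('k, 'i, 'j) payoff \<Rightarrow> ('k, 'i, 'j, 'c, 'd) transition \<Rightarrow>
   ('k \<times> 'c \<times> 'd) pmf \<Rightarrow> real \<Rightarrow> bool" where
  "is_uniform_minmax g q p v \<longleftrightarrow>
     (\<forall>\<epsilon>>0. \<exists>\<tau>. \<exists>n0\<ge>1. \<forall>n\<ge>n0. \<forall>\<sigma>. mean_payoff g q n p \<sigma> \<tau> \<le> v + \<epsilon>) \<and>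
     (\<forall>\<epsilon>>0. \<forall>\<tau>. \<exists>n0\<ge>1. \<exists>\<sigma>. \<forall>n\<ge>n0. mean_payoff g q n p \<sigma> \<tau> \<ge> v - \<epsilon>)"

definition has_uniform_value ::
  "('k, 'i, 'j) payoff \<Rightarrow> ('k, 'i, 'j, 'c, 'd) transition \<Rightarrow>
   ('k \<times> 'c \<times> 'd) pmf \<Rightarrow> bool" where
  "has_uniform_value g q p \<longleftrightarrow>
     (\<exists>v. is_uniform_maxmin g q p v \<and> is_uniform_minmax g q p v)"

end

theory Submission
  imports Defs "HOL-Complex_Analysis.Great_Picard"
begin

text \<open>
  Symmetric signals determine each other and reveal both actions. So the players always share
  the same information, and the game is a stochastic game whose state is their common belief.
  Absorption may go unnoticed, but what is played after it does not change the payoff, so strategies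
  matter only as long as the state is not absorbed. The relevant state is therefore the
  unnormalised belief \<open>\<mu>\<close> on the non-absorbing states, that is, the joint probability of the public history
  and the current state. Its updates are linear, and value functions of \<open>\<mu>\<close> are positively homogeneous
  and nonexpansive for the norm \<open>l1\<close>. This reduction is carried by
  \<open>public_expectation_transient\<close> and \<open>public_expectation_payoff\<close>.

  Let \<open>shapley f \<mu>\<close> be the value of the one-stage game at \<open>\<mu>\<close> with continuation payoff \<open>f\<close>. For
  every discount rate \<open>\<eta>\<close> the equation \<open>u = (1 - \<eta>) * shapley u\<close> has a nonexpansive solution
  (\<open>discounted_value_exists\<close>), and by the Arzela--Ascoli theorem these solutions have a
  uniform limit point \<open>v\<close> as \<open>\<eta>\<close> tends to 0 (\<open>vanishing_discount_limit_exists\<close>), which satisfies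
  \<open>v = shapley v\<close>.

  Player 1 can guarantee \<open>v\<close> uniformly. Where \<open>v\<close> is essentially nonpositive it is enough to play
  optimally for \<open>v\<close>: then \<open>v\<close> is a submartingale, and staying unabsorbed forever yields 0. Where
  \<open>v\<close> exceeds some \<open>\<epsilon> > 0\<close> the player must force absorption. Playing optimally for a discounted
  value \<open>u\<close> close to \<open>v\<close> does this, because \<open>u\<close> then has a drift of order \<open>\<eta> * u\<close>. Instead of
  switching between the two modes of play and counting the switches, the proof uses as potential
  the maximum of suitable perturbations of \<open>v\<close> and \<open>u\<close>; it is a submartingale if the player
  always follows the larger of the two (\<open>potential_with_drift\<close>). Its boundedness limits the
  expected number of stages spent unabsorbed where \<open>v\<close> exceeds \<open>\<epsilon>\<close>, uniformly in the opponent's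
  strategy (\<open>uniform_guarantee\<close>).

  Exchanging the players and negating payoffs turns \<open>v\<close> into \<open>- v\<close>
  (\<open>vanishing_discount_limit_swap\<close>), so player 2 also guarantees \<open>v\<close>, and the two guarantees
  together give the uniform value (\<open>uniform_value\<close>).
\<close>

section \<open>Values of finite matrix games\<close>
lemma pmf_of_weights:
  fixes w :: "'a::finite \<Rightarrow> real"
  assumes "\<And>a. 0 \<le> w a" and "(\<Sum>a\<in>UNIV. w a) = 1"
  obtains p :: "'a pmf" where "\<And>a. pmf p a = w a"
proof
  have "(\<integral>\<^sup>+a. ennreal (w a) \<partial>count_space UNIV) = 1"
    using assms by (simp add: nn_integral_count_space_finite sum_ennreal)
  then show "pmf (embed_pmf w) a = w a" for a
    using assms by (intro pmf_embed_pmf) auto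
qed

lemma sum_pmf_finite: "(\<Sum>a\<in>UNIV. pmf p (a::'a::finite)) = 1"
  by (rule sum_pmf_eq_1) auto

text \<open>
  If no mixed action of the column player keeps every row below \<open>v\<close>, the convex set of
  expected payoff vectors \<open>F ` S\<close> misses the open orthant \<open>D\<close> of vectors below \<open>v\<close>. A
  separating hyperplane has a nonnegative normal vector, because \<open>D\<close> is unbounded downwards,
  and the normalised normal vector is a mixed action of the row player that guarantees \<open>v\<close>.
\<close>
lemma theorem_of_the_alternative:
  fixes M :: "'i::finite \<Rightarrow> 'j::finite \<Rightarrow> real"
  shows "(\<exists>x :: 'i pmf. \<forall>j. v \<le> (\<Sum>i\<in>UNIV. pmf x i * M i j)) \<or>
         (\<exists>y :: 'j pmf. \<forall>i. (\<Sum>j\<in>UNIV. pmf y j * M i j) < v)"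
proof (rule disjCI)
  assume none: "\<not> (\<exists>y :: 'j pmf. \<forall>i. (\<Sum>j\<in>UNIV. pmf y j * M i j) < v)"
  define S :: "(real^'j) set" where "S = {y. (\<forall>j. 0 \<le> y $ j) \<and> (\<Sum>j\<in>UNIV. y $ j) = 1}"
  define F :: "real^'j \<Rightarrow> real^'i" where "F y = (\<chi> i. \<Sum>j\<in>UNIV. y $ j * M i j)" for y
  define D :: "(real^'i) set" where "D = {z. \<forall>i. z $ i < v}"
  have linF: "linear F"
    by (rule linearI)
      (auto simp: F_def vec_eq_iff algebra_simps sum.distrib sum_distrib_left)
  have "convex S"
    by (auto simp: S_def convex_def sum.distrib simp flip: sum_distrib_left)
  then have cC: "convex (F ` S)" by (rule convex_linear_image[OF linF])
  have cD: "convex D"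
    unfolding D_def convex_def by (auto intro!: convex_bound_lt)
  have axisS: "axis j 1 \<in> S" for j
    by (auto simp: S_def axis_def)
  have constD: "(\<chi> i. v - e) \<in> D" if "e > 0" for e
    using that by (auto simp: D_def)
  have disj: "D \<inter> F ` S = {}"
  proof (rule ccontr)
    assume "D \<inter> F ` S \<noteq> {}"
    then obtain y where y: "y \<in> S" "F y \<in> D" by auto
    obtain p where p: "\<And>j. pmf p j = y $ j"
      using pmf_of_weights[of "\<lambda>j. y $ j"] y(1) by (auto simp: S_def)
    have "\<forall>i. (\<Sum>j\<in>UNIV. pmf p j * M i j) < v"
      using y(2) by (auto simp: F_def D_def p)
    with none show False by blast
  qed
  obtain a b where a: "a \<noteq> 0" and below: "\<And>z. z \<in> D \<Longrightarrow> a \<bullet> z \<le> b"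
    and above: "\<And>z. z \<in> F ` S \<Longrightarrow> b \<le> a \<bullet> z"
  proof -
    have "D \<noteq> {}" "F ` S \<noteq> {}" using constD[of 1] axisS by auto
    then show ?thesis using separating_hyperplane_sets[OF cD cC _ _ disj] that by auto
  qed
  have inner_const: "a \<bullet> (\<chi> i. c) = c * (\<Sum>i\<in>UNIV. a $ i)" for c
    by (simp add: inner_vec_def sum_distrib_left mult.commute)
  have nonneg: "0 \<le> a $ i" for i
  proof (rule ccontr)
    assume "\<not> 0 \<le> a $ i"
    then have neg: "a $ i < 0" by simp
    (* t is so large that moving by t along the negative axis i pushes the inner product above b. *)
    define t where "t = (\<bar>b\<bar> + \<bar>a \<bullet> (\<chi> i. v - 1)\<bar> + 1) / - (a $ i)"
    have t: "t > 0" unfolding t_def using neg by (intro divide_pos_pos) auto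
    have "(\<chi> i. v - 1) - t *\<^sub>R axis i 1 \<in> D"
    proof -
      have "v - 1 - t * axis i 1 $ j < v" for j
        using t by (auto simp: axis_def)
      then show ?thesis by (auto simp: D_def)
    qed
    from below[OF this] have "a \<bullet> (\<chi> i. v - 1) - t * a $ i \<le> b"
      by (simp add: inner_diff_right inner_axis)
    moreover have "t * a $ i = - (\<bar>b\<bar> + \<bar>a \<bullet> (\<chi> i. v - 1)\<bar> + 1)"
      using neg by (simp add: t_def)
    ultimately show False by linarith
  qed
  define A where "A = (\<Sum>i\<in>UNIV. a $ i)"
  have "A > 0"
  proof -
    have "\<exists>i. a $ i \<noteq> 0" using a by (auto simp: vec_eq_iff)
    then obtain i where "0 < a $ i" using nonneg by (metis less_eq_real_def)
    then show ?thesis unfolding A_def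
      by (intro sum_pos2[of _ i]) (auto intro: nonneg)
  qed
  have vA: "v * A \<le> b"
  proof (rule field_le_epsilon)
    fix e :: real assume "e > 0"
    then have "e / A > 0" using \<open>A > 0\<close> by simp
    from below[OF constD[OF this]] show "v * A \<le> b + e"
      unfolding inner_const A_def[symmetric] using \<open>A > 0\<close> by (simp add: left_diff_distrib)
  qed
  obtain x where x: "\<And>i. pmf x i = a $ i / A"
    using pmf_of_weights[of "\<lambda>i. a $ i / A"] nonneg \<open>A > 0\<close>
    by (auto simp flip: sum_divide_distrib simp: A_def)
  have "v \<le> (\<Sum>i\<in>UNIV. pmf x i * M i j)" for j
  proof -
    have "b \<le> a \<bullet> F (axis j 1)" by (rule above) (use axisS in auto)
    also have "F (axis j 1) = (\<chi> i. M i j)"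
      by (simp add: F_def vec_eq_iff axis_def if_distribR if_distrib[of "\<lambda>c. c * _"] cong: if_cong)
    also have "a \<bullet> (\<chi> i. M i j) = A * (\<Sum>i\<in>UNIV. pmf x i * M i j)"
      using \<open>A > 0\<close> by (simp add: inner_vec_def x sum_distrib_left)
    finally have "v * A \<le> A * (\<Sum>i\<in>UNIV. pmf x i * M i j)" using vA by linarith
    then show ?thesis using \<open>A > 0\<close> by (simp add: mult.commute)
  qed
  then show "\<exists>x :: 'i pmf. \<forall>j. v \<le> (\<Sum>i\<in>UNIV. pmf x i * M i j)" by blast
qed

lemma guaranteed_le_defended:
  fixes M :: "'i::finite \<Rightarrow> 'j::finite \<Rightarrow> real"
  assumes "\<And>j. u \<le> (\<Sum>i\<in>UNIV. pmf x i * M i j)"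
    and "\<And>i. (\<Sum>j\<in>UNIV. pmf y j * M i j) \<le> w"
  shows "u \<le> w"
proof -
  have "u = (\<Sum>j\<in>UNIV. pmf y j * u)"
    by (simp add: sum_pmf_finite flip: sum_distrib_right)
  also have "\<dots> \<le> (\<Sum>j\<in>UNIV. pmf y j * (\<Sum>i\<in>UNIV. pmf x i * M i j))"
    by (intro sum_mono mult_left_mono assms) auto
  also have "\<dots> = (\<Sum>i\<in>UNIV. pmf x i * (\<Sum>j\<in>UNIV. pmf y j * M i j))"
    unfolding sum_distrib_left by (subst sum.swap) (simp add: mult_ac)
  also have "\<dots> \<le> (\<Sum>i\<in>UNIV. pmf x i * w)"
    by (intro sum_mono mult_left_mono assms) auto
  also have "\<dots> = w"
    by (simp add: sum_pmf_finite flip: sum_distrib_right)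
  finally show ?thesis .
qed

text \<open>
  The supremum \<open>v\<close> of the levels that the row player can guarantee is attained, and it is also
  guaranteed by the column player: if either failed, the alternative above, applied to \<open>M\<close> or
  to its negative transpose, would yield a mixed action whose finitely many payoffs are all
  strictly on the wrong side of \<open>v\<close>, hence bounded away from it.
\<close>
lemma matrix_game_minimax:
  fixes M :: "'i::finite \<Rightarrow> 'j::finite \<Rightarrow> real"
  shows "\<exists>v. (\<exists>x. \<forall>j. v \<le> (\<Sum>i\<in>UNIV. pmf x i * M i j)) \<and>
             (\<exists>y. \<forall>i. (\<Sum>j\<in>UNIV. pmf y j * M i j) \<le> v)"
proof -
  define P where "P v \<longleftrightarrow> (\<exists>x :: 'i pmf. \<forall>j. v \<le> (\<Sum>i\<in>UNIV. pmf x i * M i j))" for v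
  define v where "v = Sup (Collect P)"
  define lo where "lo = Min (range (\<lambda>(i, j). M i j))"
  define hi where "hi = Max (range (\<lambda>(i, j). M i j))"
  have lo: "lo \<le> M i j" and hi: "M i j \<le> hi" for i j
    by (auto simp: lo_def hi_def intro!: Min_le Max_ge)
  have "P lo"
  proof -
    have "lo \<le> (\<Sum>i\<in>UNIV. pmf x i * M i j)" for x :: "'i pmf" and j
    proof -
      have "lo = (\<Sum>i\<in>UNIV. pmf x i * lo)"
        by (simp add: sum_pmf_finite flip: sum_distrib_right)
      also have "\<dots> \<le> (\<Sum>i\<in>UNIV. pmf x i * M i j)"
        by (intro sum_mono mult_left_mono lo) auto
      finally show ?thesis .
    qed
    then show ?thesis by (auto simp: P_def)
  qed
  then have ne: "Collect P \<noteq> {}" by auto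
  have upper: "u \<le> w" if "P u" "\<forall>i. (\<Sum>j\<in>UNIV. pmf y j * M i j) \<le> w" for u w and y :: "'j pmf"
    using that guaranteed_le_defended[where M=M] unfolding P_def by blast
  have "\<exists>y :: 'j pmf. \<forall>i. (\<Sum>j\<in>UNIV. pmf y j * M i j) \<le> hi"
  proof -
    have "(\<Sum>j\<in>UNIV. pmf y j * M i j) \<le> hi" for y :: "'j pmf" and i
    proof -
      have "(\<Sum>j\<in>UNIV. pmf y j * M i j) \<le> (\<Sum>j\<in>UNIV. pmf y j * hi)"
        by (intro sum_mono mult_left_mono hi) auto
      also have "\<dots> = hi"
        by (simp add: sum_pmf_finite flip: sum_distrib_right)
      finally show ?thesis .
    qed
    then show ?thesis by auto
  qed
  then have bdd: "bdd_above (Collect P)"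
    using upper by (auto intro!: bdd_aboveI[of _ hi])
  have "P v"
  proof (rule ccontr)
    assume "\<not> P v"
    then obtain y :: "'j pmf" where y: "\<And>i. (\<Sum>j\<in>UNIV. pmf y j * M i j) < v"
      using theorem_of_the_alternative[of v M] by (auto simp: P_def)
    define w where "w = Max (range (\<lambda>i. \<Sum>j\<in>UNIV. pmf y j * M i j))"
    have "w < v" unfolding w_def using y by (subst Max_less_iff) auto
    moreover have "v \<le> w"
      unfolding v_def
    proof (rule cSup_least[OF ne])
      fix u assume "u \<in> Collect P"
      moreover have "\<forall>i. (\<Sum>j\<in>UNIV. pmf y j * M i j) \<le> w"
        unfolding w_def by (intro allI Max_ge) auto
      ultimately show "u \<le> w" using upper by simp
    qed
    ultimately show False by simp
  qed
  moreover have "\<exists>y :: 'j pmf. \<forall>i. (\<Sum>j\<in>UNIV. pmf y j * M i j) \<le> v"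
  proof (rule ccontr)
    assume no: "\<not> ?thesis"
    have "\<exists>x :: 'i pmf. \<forall>j. (\<Sum>i\<in>UNIV. pmf x i * - M i j) < - v"
      using theorem_of_the_alternative[of "- v" "\<lambda>j i. - M i j"] no
      by (auto simp: sum_negf)
    then obtain x :: "'i pmf" where x: "\<And>j. v < (\<Sum>i\<in>UNIV. pmf x i * M i j)"
      by (auto simp: sum_negf)
    define w where "w = Min (range (\<lambda>j. \<Sum>i\<in>UNIV. pmf x i * M i j))"
    have "v < w" unfolding w_def using x by (subst Min_gr_iff) auto
    moreover have "w \<le> (\<Sum>i\<in>UNIV. pmf x i * M i j)" for j
      unfolding w_def by (intro Min_le) auto
    then have "P w" unfolding P_def by blast
    then have "w \<le> v" unfolding v_def using bdd by (intro cSup_upper) auto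
    ultimately show False by simp
  qed
  ultimately show ?thesis by (auto simp: P_def)
qed

definition matrix_value :: "('i::finite \<Rightarrow> 'j::finite \<Rightarrow> real) \<Rightarrow> real" where
  "matrix_value M = (SOME v. (\<exists>x. \<forall>j. v \<le> (\<Sum>i\<in>UNIV. pmf x i * M i j)) \<and>
                             (\<exists>y. \<forall>i. (\<Sum>j\<in>UNIV. pmf y j * M i j) \<le> v))"

lemma
  fixes M :: "'i::finite \<Rightarrow> 'j::finite \<Rightarrow> real"
  shows optimal_mixed1: "\<exists>x. \<forall>j. matrix_value M \<le> (\<Sum>i\<in>UNIV. pmf x i * M i j)"
    and optimal_mixed2: "\<exists>y. \<forall>i. (\<Sum>j\<in>UNIV. pmf y j * M i j) \<le> matrix_value M"
  using someI_ex[OF matrix_game_minimax[of M]] unfolding matrix_value_def by blast+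

lemma le_matrix_value:
  assumes "\<And>j. u \<le> (\<Sum>i\<in>UNIV. pmf x i * M i j)"
  shows "u \<le> matrix_value M"
proof -
  obtain y where "\<And>i. (\<Sum>j\<in>UNIV. pmf y j * M i j) \<le> matrix_value M"
    using optimal_mixed2[of M] by blast
  with assms show ?thesis by (rule guaranteed_le_defended)
qed

lemma matrix_value_le:
  assumes "\<And>i. (\<Sum>j\<in>UNIV. pmf y j * M i j) \<le> w"
  shows "matrix_value M \<le> w"
proof -
  obtain x where "\<And>j. matrix_value M \<le> (\<Sum>i\<in>UNIV. pmf x i * M i j)"
    using optimal_mixed1[of M] by blast
  then show ?thesis using assms by (rule guaranteed_le_defended)
qed

lemma matrix_value_eqI:
  assumes "\<And>j. u \<le> (\<Sum>i\<in>UNIV. pmf x i * M i j)" and "\<And>i. (\<Sum>j\<in>UNIV. pmf y j * M i j) \<le> u"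
  shows "matrix_value M = u"
  using le_matrix_value[OF assms(1)] matrix_value_le[OF assms(2)] by (rule antisym[rotated])

lemma matrix_value_const: "matrix_value (\<lambda>i j. c) = c"
  by (rule matrix_value_eqI) (simp_all add: sum_pmf_finite flip: sum_distrib_right)

lemma matrix_value_le_add:
  assumes "\<And>i j. M i j \<le> M' i j + d"
  shows "matrix_value M \<le> matrix_value M' + d"
proof -
  obtain y where y: "\<And>i. (\<Sum>j\<in>UNIV. pmf y j * M' i j) \<le> matrix_value M'"
    using optimal_mixed2 by blast
  show ?thesis
  proof (rule matrix_value_le[where y = y])
    fix i
    have "(\<Sum>j\<in>UNIV. pmf y j * M i j) \<le> (\<Sum>j\<in>UNIV. pmf y j * (M' i j + d))"
      by (intro sum_mono mult_left_mono assms) auto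
    also have "\<dots> = (\<Sum>j\<in>UNIV. pmf y j * M' i j) + d"
      by (simp add: distrib_left sum.distrib sum_pmf_finite flip: sum_distrib_right)
    finally show "(\<Sum>j\<in>UNIV. pmf y j * M i j) \<le> matrix_value M' + d" using y[of i] by simp
  qed
qed

lemma matrix_value_dist:
  assumes "\<And>i j. \<bar>M i j - M' i j\<bar> \<le> d"
  shows "\<bar>matrix_value M - matrix_value M'\<bar> \<le> d"
proof -
  have "M i j \<le> M' i j + d" "M' i j \<le> M i j + d" for i j
    using assms[of i j] by auto
  from matrix_value_le_add[of M M' d, OF this(1)] matrix_value_le_add[of M' M d, OF this(2)]
  show ?thesis by auto
qed

lemma matrix_value_scale:
  assumes "0 \<le> a"
  shows "matrix_value (\<lambda>i j. a * M i j) = a * matrix_value M"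
proof -
  obtain x y where "\<And>j. matrix_value M \<le> (\<Sum>i\<in>UNIV. pmf x i * M i j)"
    and "\<And>i. (\<Sum>j\<in>UNIV. pmf y j * M i j) \<le> matrix_value M"
    using optimal_mixed1[of M] optimal_mixed2[of M] by blast
  moreover have "(\<Sum>i\<in>UNIV. pmf x i * (a * M i j)) = a * (\<Sum>i\<in>UNIV. pmf x i * M i j)"
    "(\<Sum>j\<in>UNIV. pmf y j * (a * M i j)) = a * (\<Sum>j\<in>UNIV. pmf y j * M i j)" for i j
    by (simp_all add: sum_distrib_left mult.left_commute)
  ultimately show ?thesis
    using assms
    by (intro matrix_value_eqI[where x = x and y = y]) (auto intro!: mult_left_mono)
qed

lemma matrix_value_neg_transpose: "matrix_value (\<lambda>j i. - M i j) = - matrix_value M"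
proof -
  obtain x y where "\<And>j. matrix_value M \<le> (\<Sum>i\<in>UNIV. pmf x i * M i j)"
    and "\<And>i. (\<Sum>j\<in>UNIV. pmf y j * M i j) \<le> matrix_value M"
    using optimal_mixed1[of M] optimal_mixed2[of M] by blast
  then show ?thesis
    by (intro matrix_value_eqI[where x = y and y = x]) (auto simp: sum_negf)
qed

section \<open>Nonexpansive positively homogeneous functions\<close>
definition l1 :: "real^'k::finite \<Rightarrow> real" where
  "l1 x = (\<Sum>k\<in>UNIV. \<bar>x $ k\<bar>)"

lemma l1_nonneg [simp]: "0 \<le> l1 x"
  by (simp add: l1_def sum_nonneg)

lemma l1_zero [simp]: "l1 0 = 0"
  by (simp add: l1_def)

lemma l1_scale [simp]: "l1 (a *\<^sub>R x) = \<bar>a\<bar> * l1 x"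
  by (simp add: l1_def abs_mult sum_distrib_left)

lemma l1_minus_commute: "l1 (x - y) = l1 (y - x)"
  by (simp add: l1_def abs_minus_commute)

lemma l1_triangle: "l1 x \<le> l1 y + l1 (x - y)"
  unfolding l1_def sum.distrib[symmetric] by (intro sum_mono) auto

lemma norm_le_l1: "norm x \<le> l1 x"
  unfolding l1_def by (rule norm_le_l1_cart)

lemma l1_le_norm: "l1 (x :: real^'k) \<le> real CARD('k::finite) * norm x"
  unfolding l1_def by (rule sum_bounded_above[THEN order_trans]) (auto simp: component_le_norm_cart)

text \<open>
  The class that contains all value functions of unnormalised beliefs: Lipschitz constant 1 for
  \<open>l1\<close> gives the compactness of the family of discounted values, homogeneity makes it
  legitimate to work with unnormalised beliefs.
\<close>
definition admissible :: "(real^'k::finite \<Rightarrow> real) \<Rightarrow> bool" where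
  "admissible f \<longleftrightarrow> (\<forall>x y. \<bar>f x - f y\<bar> \<le> l1 (x - y)) \<and> (\<forall>a\<ge>0. \<forall>x. f (a *\<^sub>R x) = a * f x)"

lemma admissibleD:
  assumes "admissible f"
  shows "\<bar>f x - f y\<bar> \<le> l1 (x - y)" "0 \<le> a \<Longrightarrow> f (a *\<^sub>R x) = a * f x" "\<bar>f x\<bar> \<le> l1 x"
proof -
  show lip: "\<bar>f x - f y\<bar> \<le> l1 (x - y)" for x y using assms by (simp add: admissible_def)
  show hom: "0 \<le> a \<Longrightarrow> f (a *\<^sub>R x) = a * f x" for a x using assms by (simp add: admissible_def)
  show "\<bar>f x\<bar> \<le> l1 x" using lip[of x 0] hom[of 0 0] by simp
qed

lemma admissible_neg: "admissible f \<Longrightarrow> admissible (\<lambda>x. - f x)"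
  by (auto simp: admissible_def abs_minus_commute)

section \<open>Recursive games on unnormalised beliefs\<close>

text \<open>
  The state \<open>\<mu>\<close> is an unnormalised belief on the states that are not absorbing. After the actions
  \<open>i\<close> and \<open>j\<close>, the amount \<open>R i j \<mu>\<close> is the payoff carried by the mass that is absorbed, and \<open>B s \<mu>\<close>
  is the remaining mass restricted to the public signal \<open>s\<close>; the signal reveals the actions
  \<open>act1 s\<close> and \<open>act2 s\<close>. Payoffs lie in the interval from -1 to 1, whence the balance
  inequality; it is imposed on signed vectors as well, because the Lipschitz estimates apply it to
  differences of beliefs.
\<close>
locale belief_game =
  fixes B :: "'s::finite \<Rightarrow> real^'k::finite \<Rightarrow> real^'k"
    and R :: "'i::finite \<Rightarrow> 'j::finite \<Rightarrow> real^'k \<Rightarrow> real"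
    and act1 :: "'s \<Rightarrow> 'i" and act2 :: "'s \<Rightarrow> 'j"
  assumes linear_B: "linear (B s)" and linear_R: "linear (R i j)"
    and mass_balance: "\<bar>R i j \<mu>\<bar> + (\<Sum>s | act1 s = i \<and> act2 s = j. l1 (B s \<mu>)) \<le> l1 \<mu>"
begin

definition continuation :: "(real^'k \<Rightarrow> real) \<Rightarrow> real^'k \<Rightarrow> 'i \<Rightarrow> 'j \<Rightarrow> real" where
  "continuation f \<mu> i j = R i j \<mu> + (\<Sum>s | act1 s = i \<and> act2 s = j. f (B s \<mu>))"

definition shapley :: "(real^'k \<Rightarrow> real) \<Rightarrow> real^'k \<Rightarrow> real" where
  "shapley f \<mu> = matrix_value (continuation f \<mu>)"

lemma continuation_scale:
  assumes "\<And>a x. 0 \<le> a \<Longrightarrow> f (a *\<^sub>R x) = a * f x" "0 \<le> a"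
  shows "continuation f (a *\<^sub>R \<mu>) i j = a * continuation f \<mu> i j"
  using assms by (simp add: continuation_def linear_B linear_R linear_scale distrib_left sum_distrib_left)

lemma continuation_dist:
  assumes "admissible f"
  shows "\<bar>continuation f \<mu> i j - continuation f \<nu> i j\<bar> \<le> l1 (\<mu> - \<nu>)"
proof -
  have "\<bar>continuation f \<mu> i j - continuation f \<nu> i j\<bar>
      = \<bar>R i j (\<mu> - \<nu>) + (\<Sum>s | act1 s = i \<and> act2 s = j. f (B s \<mu>) - f (B s \<nu>))\<bar>"
    by (simp add: continuation_def linear_diff[OF linear_R] sum_subtractf)
  also have "\<dots> \<le> \<bar>R i j (\<mu> - \<nu>)\<bar> + (\<Sum>s | act1 s = i \<and> act2 s = j. \<bar>f (B s \<mu>) - f (B s \<nu>)\<bar>)"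
    by (rule order_trans[OF abs_triangle_ineq add_left_mono[OF sum_abs]])
  also have "\<dots> \<le> \<bar>R i j (\<mu> - \<nu>)\<bar> + (\<Sum>s | act1 s = i \<and> act2 s = j. l1 (B s (\<mu> - \<nu>)))"
    using admissibleD(1)[OF assms] by (intro add_left_mono sum_mono) (simp add: linear_diff[OF linear_B])
  also have "\<dots> \<le> l1 (\<mu> - \<nu>)" by (rule mass_balance)
  finally show ?thesis .
qed

lemma shapley_mono:
  assumes "\<And>x. f x \<le> h x"
  shows "shapley f \<mu> \<le> shapley h \<mu>"
  using matrix_value_le_add[of "continuation f \<mu>" "continuation h \<mu>" 0] assms
  by (simp add: shapley_def continuation_def sum_mono)

lemma shapley_dist:
  assumes "\<And>x. \<bar>f x - h x\<bar> \<le> d * l1 x" "0 \<le> d"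
  shows "\<bar>shapley f \<mu> - shapley h \<mu>\<bar> \<le> d * l1 \<mu>"
  unfolding shapley_def
proof (rule matrix_value_dist)
  fix i j
  have "\<bar>continuation f \<mu> i j - continuation h \<mu> i j\<bar>
      = \<bar>\<Sum>s | act1 s = i \<and> act2 s = j. f (B s \<mu>) - h (B s \<mu>)\<bar>"
    by (simp add: continuation_def sum_subtractf)
  also have "\<dots> \<le> (\<Sum>s | act1 s = i \<and> act2 s = j. \<bar>f (B s \<mu>) - h (B s \<mu>)\<bar>)"
    by (rule sum_abs)
  also have "\<dots> \<le> (\<Sum>s | act1 s = i \<and> act2 s = j. d * l1 (B s \<mu>))"
    by (intro sum_mono assms)
  also have "\<dots> = d * (\<Sum>s | act1 s = i \<and> act2 s = j. l1 (B s \<mu>))"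
    by (simp add: sum_distrib_left)
  also have "\<dots> \<le> d * l1 \<mu>"
    using mass_balance[of i j \<mu>] assms(2) by (intro mult_left_mono) auto
  finally show "\<bar>continuation f \<mu> i j - continuation h \<mu> i j\<bar> \<le> d * l1 \<mu>" .
qed

lemma admissible_shapley:
  assumes "admissible f" "0 \<le> c" "c \<le> 1"
  shows "admissible (\<lambda>\<mu>. c * shapley f \<mu>)"
  unfolding admissible_def
proof (intro conjI allI impI)
  fix \<mu> \<nu> :: "real^'k"
  have "\<bar>shapley f \<mu> - shapley f \<nu>\<bar> \<le> l1 (\<mu> - \<nu>)"
    unfolding shapley_def by (intro matrix_value_dist continuation_dist assms)
  then have "c * \<bar>shapley f \<mu> - shapley f \<nu>\<bar> \<le> 1 * l1 (\<mu> - \<nu>)"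
    using assms by (intro mult_mono) auto
  then show "\<bar>c * shapley f \<mu> - c * shapley f \<nu>\<bar> \<le> l1 (\<mu> - \<nu>)"
    using assms by (simp add: abs_mult flip: right_diff_distrib)
next
  fix a :: real and \<mu> :: "real^'k" assume a: "0 \<le> a"
  have "continuation f (a *\<^sub>R \<mu>) = (\<lambda>i j. a * continuation f \<mu> i j)"
    using continuation_scale[of f a] admissibleD(2)[OF assms(1)] a by (intro ext) simp
  then show "c * shapley f (a *\<^sub>R \<mu>) = a * (c * shapley f \<mu>)"
    using a by (simp add: shapley_def matrix_value_scale)
qed

text \<open>
  As in the Knaster--Tarski theorem, the solution is the pointwise supremum of all admissible
  subsolutions. Admissibility is inherited by such suprema, and the discounted operator maps
  subsolutions to subsolutions, so the supremum is a fixed point.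
\<close>
lemma discounted_value_exists:
  assumes "0 < c" "c \<le> 1"
  shows "\<exists>u. admissible u \<and> (\<forall>\<mu>. u \<mu> = c * shapley u \<mu>)"
proof -
  define F where "F = {f. admissible f \<and> (\<forall>\<mu>. f \<mu> \<le> c * shapley f \<mu>)}"
  define u where "u \<mu> = (SUP f\<in>F. f \<mu>)" for \<mu>
  have bot: "(\<lambda>\<mu>. - l1 \<mu>) \<in> F"
  proof -
    have "admissible (\<lambda>\<mu> :: real^'k. - l1 \<mu>)"
      unfolding admissible_def
    proof (intro conjI allI impI)
      show "\<bar>- l1 x - - l1 y\<bar> \<le> l1 (x - y)" for x y :: "real^'k"
        using l1_triangle[of x y] l1_triangle[of y x] l1_minus_commute[of x y] by linarith
    qed simp
    moreover have "- l1 \<mu> \<le> c * shapley (\<lambda>\<mu>. - l1 \<mu>) \<mu>" for \<mu>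
    proof -
      have "- l1 \<mu> \<le> continuation (\<lambda>\<mu>. - l1 \<mu>) \<mu> i j" for i j
        using mass_balance[of i j \<mu>] by (simp add: continuation_def sum_negf)
      then have "- l1 \<mu> \<le> shapley (\<lambda>\<mu>. - l1 \<mu>) \<mu>"
        using matrix_value_le_add[of "\<lambda>i j. - l1 \<mu>" "continuation (\<lambda>\<mu>. - l1 \<mu>) \<mu>" 0]
        by (simp add: shapley_def matrix_value_const)
      then have "c * (- l1 \<mu>) \<le> c * shapley (\<lambda>\<mu>. - l1 \<mu>) \<mu>"
        using assms by (intro mult_left_mono) auto
      moreover have "c * l1 \<mu> \<le> 1 * l1 \<mu>" using assms by (intro mult_right_mono) auto
      ultimately show ?thesis by simp
    qed
    ultimately show ?thesis by (simp add: F_def)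
  qed
  then have ne: "F \<noteq> {}" by auto
  have "f \<mu> \<le> l1 \<mu>" if "f \<in> F" for f \<mu>
    using that admissibleD(3)[of f \<mu>] by (auto simp: F_def)
  then have bdd: "bdd_above ((\<lambda>f. f \<mu>) ` F)" for \<mu>
    by (auto intro!: bdd_aboveI)
  have upper: "f \<mu> \<le> u \<mu>" if "f \<in> F" for f \<mu>
    unfolding u_def using that by (intro cSUP_upper bdd)
  have least: "u \<mu> \<le> z" if "\<And>f. f \<in> F \<Longrightarrow> f \<mu> \<le> z" for \<mu> z
    unfolding u_def using that by (intro cSUP_least ne)
  have lip: "u \<mu> \<le> u \<nu> + l1 (\<mu> - \<nu>)" for \<mu> \<nu>
  proof (rule least)
    fix f assume f: "f \<in> F"
    then have "\<bar>f \<mu> - f \<nu>\<bar> \<le> l1 (\<mu> - \<nu>)" by (auto simp: F_def dest: admissibleD)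
    then show "f \<mu> \<le> u \<nu> + l1 (\<mu> - \<nu>)" using upper[OF f, of \<nu>] by linarith
  qed
  have hom_le: "u (a *\<^sub>R \<mu>) \<le> a * u \<mu>" if "0 \<le> a" for a \<mu>
  proof (rule least)
    fix f assume f: "f \<in> F"
    then have "f (a *\<^sub>R \<mu>) = a * f \<mu>" using that by (auto simp: F_def dest: admissibleD)
    then show "f (a *\<^sub>R \<mu>) \<le> a * u \<mu>" using upper[OF f] that by (simp add: mult_left_mono)
  qed
  have hom_ge: "a * u \<mu> \<le> u (a *\<^sub>R \<mu>)" if "0 \<le> a" for a \<mu>
  proof (cases "a = 0")
    case True
    then show ?thesis using upper[OF bot, of 0] by simp
  next
    case False
    then have "u (inverse a *\<^sub>R (a *\<^sub>R \<mu>)) \<le> inverse a * u (a *\<^sub>R \<mu>)"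
      using that by (intro hom_le) simp
    then show ?thesis using False that by (simp add: field_simps)
  qed
  have adm: "admissible u"
    unfolding admissible_def
  proof (intro conjI allI impI)
    show "\<bar>u x - u y\<bar> \<le> l1 (x - y)" for x y
      using lip[of x y] lip[of y x] l1_minus_commute[of x y] by linarith
  qed (use hom_le hom_ge in \<open>auto intro: antisym\<close>)
  have sub: "u \<mu> \<le> c * shapley u \<mu>" for \<mu>
  proof (rule least)
    fix f assume f: "f \<in> F"
    then have "f \<mu> \<le> c * shapley f \<mu>" by (simp add: F_def)
    also have "\<dots> \<le> c * shapley u \<mu>"
      using assms by (intro mult_left_mono shapley_mono upper f) auto
    finally show "f \<mu> \<le> c * shapley u \<mu>" .
  qed
  have "(\<lambda>\<mu>. c * shapley u \<mu>) \<in> F"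
    unfolding F_def using assms sub
    by (auto intro!: admissible_shapley adm shapley_mono)
  then have "c * shapley u \<mu> \<le> u \<mu>" for \<mu> using upper by blast
  with sub adm show ?thesis by (intro exI[of _ u]) (auto intro: antisym)
qed

section \<open>Limits of discounted values\<close>

text \<open>
  A uniform limit of discounted values along some sequence of discount rates \<open>\<eta>\<close> tending to 0.
  That such a limit does not depend on the sequence only follows a posteriori, since both
  players turn out to guarantee it.
\<close>
definition vanishing_discount_limit :: "(real^'k \<Rightarrow> real) \<Rightarrow> bool" where
  "vanishing_discount_limit v \<longleftrightarrow> admissible v \<and>
     (\<forall>\<delta>>0. \<exists>\<eta> u. 0 < \<eta> \<and> \<eta> < 1 \<and> \<eta> < \<delta> \<and> admissible u \<and>
        (\<forall>\<mu>. u \<mu> = (1 - \<eta>) * shapley u \<mu>) \<and> (\<forall>\<mu>. \<bar>u \<mu> - v \<mu>\<bar> \<le> \<delta> * l1 \<mu>))"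

text \<open>
  By homogeneity, discounted values are determined on the unit ball, where they are uniformly
  bounded and equicontinuous. So the Arzela--Ascoli theorem applies there, and uniform
  convergence on the ball becomes convergence uniform relative to \<open>l1\<close>.
\<close>
lemma vanishing_discount_limit_exists: "\<exists>v. vanishing_discount_limit v"
proof -
  define lam :: "nat \<Rightarrow> real" where "lam n = 1 / real (n + 2)" for n
  have lam: "0 < lam n" "lam n < 1" for n by (auto simp: lam_def)
  have "\<exists>u. admissible u \<and> (\<forall>\<mu>. u \<mu> = (1 - lam n) * shapley u \<mu>)" for n
    using lam[of n] by (intro discounted_value_exists) auto
  then obtain u where adm: "\<And>n. admissible (u n)"
    and fixp: "\<And>n \<mu>. u n \<mu> = (1 - lam n) * shapley (u n) \<mu>"
    by metis
  let ?C = "real CARD('k)"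
  have lip: "\<bar>u n x - u n y\<bar> \<le> ?C * norm (x - y)" for n x y
    using admissibleD(1)[OF adm] l1_le_norm order_trans by blast
  have compact: "compact (cball (0 :: real^'k) 1)" by (rule compact_cball)
  have bound: "norm (u n x) \<le> ?C" if "x \<in> cball 0 1" for n x
  proof -
    have "\<bar>u n x\<bar> \<le> ?C * norm x" using admissibleD(3)[OF adm] l1_le_norm order_trans by blast
    also have "\<dots> \<le> ?C * 1" using that by (intro mult_left_mono) auto
    finally show ?thesis by simp
  qed
  have equi: "\<exists>d. 0 < d \<and> (\<forall>n y. y \<in> cball 0 1 \<and> norm (x - y) < d \<longrightarrow> norm (u n x - u n y) < e)"
    if "0 < e" for x and e :: real
  proof (intro exI[of _ "e / ?C"] conjI allI impI)
    show "0 < e / ?C" using that by simp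
    fix n y assume "y \<in> cball 0 1 \<and> norm (x - y) < e / ?C"
    then have "?C * norm (x - y) < e" by (simp add: field_simps)
    then show "norm (u n x - u n y) < e" using lip[of n x y] by simp
  qed
  obtain w and r :: "nat \<Rightarrow> nat" where r: "strict_mono r"
    and conv: "\<And>e. 0 < e \<Longrightarrow> \<exists>N. \<forall>n x. n \<ge> N \<and> x \<in> cball 0 1 \<longrightarrow> norm (u (r n) x - w x) < e"
  proof -
    have "\<exists>w (r :: nat \<Rightarrow> nat). strict_mono r \<and> (\<forall>e>0. \<exists>N. \<forall>n x. n \<ge> N \<and> x \<in> cball 0 1 \<longrightarrow> norm (u (r n) x - w x) < e)"
    proof (rule Arzela_Ascoli[OF compact, of u ?C])
      show "norm (u n x) \<le> ?C" if "x \<in> cball 0 1" for n x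
        using that by (rule bound)
      show "\<exists>d. 0 < d \<and> (\<forall>n y. y \<in> cball 0 1 \<and> norm (x - y) < d \<longrightarrow> norm (u n x - u n y) < e)"
        if "0 < e" for x and e :: real
        using that by (rule equi)
    qed blast
    then show ?thesis using that by blast
  qed
  (* The homogeneous extension of the limit on the unit sphere of l1. At x = 0 the quotient is
     the default value 1 / 0 = 0, and v 0 = 0 because of the factor l1 x. *)
  define v where "v x = l1 x * w ((1 / l1 x) *\<^sub>R x)" for x
  have close: "\<bar>u (r n) x - v x\<bar> \<le> e * l1 x"
    if "\<forall>x. x \<in> cball 0 1 \<longrightarrow> norm (u (r n) x - w x) < e" for n x e
  proof (cases "l1 x = 0")
    case True
    then show ?thesis using admissibleD(3)[OF adm, of "r n" x] by (simp add: v_def)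
  next
    case False
    let ?y = "(1 / l1 x) *\<^sub>R x"
    have pos: "l1 x > 0" using False l1_nonneg[of x] by linarith
    have "l1 ?y = 1" using pos by simp
    then have "?y \<in> cball 0 1" using norm_le_l1[of ?y] by (simp only: mem_cball dist_0_norm)
    then have "\<bar>u (r n) ?y - w ?y\<bar> \<le> e" using that by (auto intro: less_imp_le)
    then have "l1 x * \<bar>u (r n) ?y - w ?y\<bar> \<le> l1 x * e" using pos by (intro mult_left_mono) auto
    moreover have "l1 x * \<bar>u (r n) ?y - w ?y\<bar> = \<bar>l1 x * u (r n) ?y - v x\<bar>"
      using pos by (simp add: v_def abs_mult flip: right_diff_distrib)
    moreover have "l1 x * u (r n) ?y = u (r n) x"
      using admissibleD(2)[OF adm, of "1 / l1 x" "r n" x] pos by simp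
    ultimately show ?thesis by (simp add: mult.commute)
  qed
  have conv': "\<exists>N. \<forall>n\<ge>N. \<forall>x. \<bar>u (r n) x - v x\<bar> \<le> e * l1 x" if "0 < e" for e
    using conv[OF that] close by metis
  have lim: "(\<lambda>n. u (r n) x) \<longlonglongrightarrow> v x" for x
  proof (rule LIMSEQ_I)
    fix e :: real assume e: "0 < e"
    have pos: "l1 x + 1 > 0" using l1_nonneg[of x] by linarith
    then obtain N where N: "\<And>n. n \<ge> N \<Longrightarrow> \<bar>u (r n) x - v x\<bar> \<le> e / (l1 x + 1) * l1 x"
      using conv'[of "e / (l1 x + 1)"] e by auto
    have "e / (l1 x + 1) * l1 x < e" using pos e by (simp add: field_simps)
    then show "\<exists>N. \<forall>n\<ge>N. norm (u (r n) x - v x) < e"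
      using N by (metis order_le_less_trans real_norm_def)
  qed
  have "admissible v"
    unfolding admissible_def
  proof (intro conjI allI impI)
    fix x y
    have "(\<lambda>n. \<bar>u (r n) x - u (r n) y\<bar>) \<longlonglongrightarrow> \<bar>v x - v y\<bar>"
      by (intro tendsto_intros lim)
    then show "\<bar>v x - v y\<bar> \<le> l1 (x - y)"
      by (rule LIMSEQ_le_const2) (auto intro!: admissibleD(1)[OF adm])
  next
    fix a :: real and x assume "0 \<le> a"
    then have "(\<lambda>n. u (r n) (a *\<^sub>R x)) = (\<lambda>n. a * u (r n) x)"
      using admissibleD(2)[OF adm] by auto
    then have "(\<lambda>n. u (r n) (a *\<^sub>R x)) \<longlonglongrightarrow> a * v x"
      by (simp add: tendsto_mult_left lim)
    with lim show "v (a *\<^sub>R x) = a * v x" by (rule LIMSEQ_unique)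
  qed
  moreover have "\<exists>\<eta> u. 0 < \<eta> \<and> \<eta> < 1 \<and> \<eta> < \<delta> \<and> admissible u \<and>
        (\<forall>\<mu>. u \<mu> = (1 - \<eta>) * shapley u \<mu>) \<and> (\<forall>\<mu>. \<bar>u \<mu> - v \<mu>\<bar> \<le> \<delta> * l1 \<mu>)" if \<delta>: "0 < \<delta>" for \<delta>
  proof -
    obtain N where N: "\<And>n x. n \<ge> N \<Longrightarrow> \<bar>u (r n) x - v x\<bar> \<le> \<delta> * l1 x"
      using conv'[OF \<delta>] by auto
    obtain N' :: nat where N': "1 / \<delta> < real N'" using reals_Archimedean2 by blast
    define n where "n = max N N'"
    have "1 / \<delta> < real (r n + 2)"
      using N' seq_suble[OF r, of n] by (simp add: n_def max_def split: if_splits)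
    then have "lam (r n) < \<delta>" using \<delta> by (simp add: lam_def field_simps)
    moreover have "n \<ge> N" by (simp add: n_def)
    ultimately show ?thesis
      using lam adm fixp N by (intro exI[of _ "lam (r n)"] exI[of _ "u (r n)"]) blast
  qed
  ultimately show ?thesis unfolding vanishing_discount_limit_def by blast
qed

lemma vanishing_discount_limit_fixpoint:
  assumes "vanishing_discount_limit v"
  shows "shapley v \<mu> = v \<mu>"
proof -
  have "\<bar>shapley v \<mu> - v \<mu>\<bar> \<le> e" if e: "0 < e" for e
  proof -
    have pos: "0 < 3 * l1 \<mu> + 1" using l1_nonneg[of \<mu>] by linarith
    define \<delta> where "\<delta> = e / (3 * l1 \<mu> + 1)"
    have "0 < \<delta>" using e pos by (simp add: \<delta>_def)
    then obtain \<eta> u where l: "0 < \<eta>" "\<eta> < 1" "\<eta> < \<delta>" and adm: "admissible u"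
      and fixp: "u \<mu> = (1 - \<eta>) * shapley u \<mu>" and close: "\<And>x. \<bar>u x - v x\<bar> \<le> \<delta> * l1 x"
      using assms unfolding vanishing_discount_limit_def by metis
    have "\<bar>shapley u \<mu> - shapley v \<mu>\<bar> \<le> \<delta> * l1 \<mu>"
      using \<open>0 < \<delta>\<close> by (intro shapley_dist close) auto
    moreover have "\<bar>u \<mu> - v \<mu>\<bar> \<le> \<delta> * l1 \<mu>" by (rule close)
    moreover have "\<bar>shapley u \<mu> - u \<mu>\<bar> \<le> \<delta> * l1 \<mu>"
    proof -
      have "\<bar>shapley u \<mu>\<bar> \<le> l1 \<mu>"
        using admissibleD(3)[OF admissible_shapley[OF adm, of 1]] by simp
      then have "\<eta> * \<bar>shapley u \<mu>\<bar> \<le> \<delta> * l1 \<mu>" using l by (intro mult_mono) auto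
      moreover have "shapley u \<mu> - u \<mu> = \<eta> * shapley u \<mu>" using fixp by (simp add: algebra_simps)
      ultimately show ?thesis using l by (simp add: abs_mult)
    qed
    ultimately have "\<bar>shapley v \<mu> - v \<mu>\<bar> \<le> 3 * (\<delta> * l1 \<mu>)" by linarith
    also have "\<dots> \<le> e" using e pos by (simp add: \<delta>_def field_simps)
    finally show ?thesis .
  qed
  from this[of "\<bar>shapley v \<mu> - v \<mu>\<bar> / 2"] show ?thesis
    by (cases "shapley v \<mu> = v \<mu>") auto
qed

end

text \<open>
  Exchanging the players and negating the payoff is a symmetry of the setting. Everything proved
  for player 1 below therefore also holds for player 2.
\<close>
lemma belief_game_swap:
  assumes "belief_game B R act1 act2"
  shows "belief_game B (\<lambda>j i \<mu>. - R i j \<mu>) act2 act1"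
proof -
  interpret belief_game B R act1 act2 by fact
  show ?thesis
  proof (rule belief_game.intro)
    show "\<bar>- R i j \<mu>\<bar> + (\<Sum>s | act2 s = j \<and> act1 s = i. l1 (B s \<mu>)) \<le> l1 \<mu>" for i j \<mu>
      using mass_balance[of i j \<mu>] by (simp add: conj_commute)
  qed (intro linear_B linear_compose_neg linear_R)+
qed

lemma vanishing_discount_limit_swap:
  assumes "belief_game B R act1 act2"
    and "belief_game.vanishing_discount_limit B R act1 act2 v"
  shows "belief_game.vanishing_discount_limit B (\<lambda>j i \<mu>. - R i j \<mu>) act2 act1 (\<lambda>\<mu>. - v \<mu>)"
proof -
  interpret G: belief_game B R act1 act2 by fact
  interpret S: belief_game B "\<lambda>j i \<mu>. - R i j \<mu>" act2 act1
    using assms(1) by (rule belief_game_swap)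
  have swap: "S.shapley (\<lambda>\<mu>. - f \<mu>) \<mu> = - G.shapley f \<mu>" for f \<mu>
    unfolding S.shapley_def G.shapley_def matrix_value_neg_transpose[symmetric]
    by (rule arg_cong[where f = matrix_value], intro ext)
       (simp add: S.continuation_def G.continuation_def sum_negf conj_commute)
  show ?thesis
    unfolding S.vanishing_discount_limit_def
  proof (intro conjI allI impI)
    show "admissible (\<lambda>\<mu>. - v \<mu>)"
      using assms(2) by (auto simp: G.vanishing_discount_limit_def intro: admissible_neg)
    fix \<delta> :: real assume "0 < \<delta>"
    then obtain \<eta> u where \<eta>: "0 < \<eta>" "\<eta> < 1" "\<eta> < \<delta>" and adm: "admissible u"
      and fixp: "\<And>\<mu>. u \<mu> = (1 - \<eta>) * G.shapley u \<mu>"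
      and close: "\<And>\<mu>. \<bar>u \<mu> - v \<mu>\<bar> \<le> \<delta> * l1 \<mu>"
      using assms(2) unfolding G.vanishing_discount_limit_def by metis
    have "- u \<mu> = (1 - \<eta>) * S.shapley (\<lambda>\<mu>. - u \<mu>) \<mu>" for \<mu>
      unfolding swap using fixp[of \<mu>] by linarith
    moreover have "\<bar>- u \<mu> - - v \<mu>\<bar> \<le> \<delta> * l1 \<mu>" for \<mu>
      using close[of \<mu>] by linarith
    ultimately show "\<exists>\<eta> u. 0 < \<eta> \<and> \<eta> < 1 \<and> \<eta> < \<delta> \<and> admissible u \<and>
        (\<forall>\<mu>. u \<mu> = (1 - \<eta>) * S.shapley u \<mu>) \<and> (\<forall>\<mu>. \<bar>u \<mu> - - v \<mu>\<bar> \<le> \<delta> * l1 \<mu>)"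
      using \<eta> admissible_neg[OF adm] by (intro exI[of _ \<eta>] exI[of _ "\<lambda>\<mu>. - u \<mu>"]) blast
  qed
qed

section \<open>Plays of a belief game\<close>
text \<open>
  Public histories are lists of signals with the most recent signal first. Stage \<open>n\<close>, counted
  from 0, starts once \<open>n + 1\<close> signals have been received.
\<close>
definition stage_histories :: "nat \<Rightarrow> 's::finite list set" where
  "stage_histories n = {h. length h = Suc n}"

lemma sum_stage_histories_0:
  fixes F :: "'s::finite list \<Rightarrow> real"
  shows "(\<Sum>h\<in>stage_histories 0. F h) = (\<Sum>s\<in>UNIV. F [s])"
proof -
  have "(stage_histories 0 :: 's list set) = range (\<lambda>s. [s])"
    by (auto simp: stage_histories_def length_Suc_conv)
  then show ?thesis by (simp add: sum.reindex inj_def)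
qed

lemma sum_stage_histories_Suc:
  fixes F :: "'s::finite list \<Rightarrow> real"
  shows "(\<Sum>h\<in>stage_histories (Suc n). F h) = (\<Sum>h\<in>stage_histories n. \<Sum>s\<in>UNIV. F (s # h))"
proof -
  have "(stage_histories (Suc n) :: 's list set) = (\<lambda>(h, s). s # h) ` (stage_histories n \<times> UNIV)"
    by (auto simp: stage_histories_def length_Suc_conv image_def)
  moreover have "inj_on (\<lambda>(h, s). s # h) (stage_histories n \<times> (UNIV :: 's set))"
    by (auto simp: inj_on_def)
  ultimately show ?thesis
    by (simp add: sum.reindex sum.cartesian_product case_prod_unfold)
qed

definition mixed_payoff :: "'i::finite pmf \<Rightarrow> 'j::finite pmf \<Rightarrow> ('i \<Rightarrow> 'j \<Rightarrow> real) \<Rightarrow> real" where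
  "mixed_payoff p r M = (\<Sum>i\<in>UNIV. \<Sum>j\<in>UNIV. pmf p i * pmf r j * M i j)"

lemma mixed_payoff_mono:
  assumes "\<And>i j. M i j \<le> M' i j"
  shows "mixed_payoff p r M \<le> mixed_payoff p r M'"
  unfolding mixed_payoff_def by (intro sum_mono mult_left_mono assms) auto

lemma mixed_payoff_add:
  "mixed_payoff p r (\<lambda>i j. M i j + M' i j) = mixed_payoff p r M + mixed_payoff p r M'"
  by (simp add: mixed_payoff_def distrib_left sum.distrib)

lemma mixed_payoff_const: "mixed_payoff p r (\<lambda>i j. c) = c"
  by (simp add: mixed_payoff_def sum_pmf_finite flip: sum_distrib_left sum_distrib_right)

lemma le_mixed_payoff:
  assumes "\<And>j. c \<le> (\<Sum>i\<in>UNIV. pmf p i * M i j)"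
  shows "c \<le> mixed_payoff p r M"
proof -
  have "c = (\<Sum>j\<in>UNIV. pmf r j * c)"
    by (simp add: sum_pmf_finite flip: sum_distrib_right)
  also have "\<dots> \<le> (\<Sum>j\<in>UNIV. pmf r j * (\<Sum>i\<in>UNIV. pmf p i * M i j))"
    by (intro sum_mono mult_left_mono assms) auto
  also have "\<dots> = mixed_payoff p r M"
    unfolding mixed_payoff_def sum_distrib_left by (subst sum.swap) (simp add: mult_ac)
  finally show ?thesis .
qed

context belief_game
begin

text \<open>
  The belief weighted with the probability that the players choose the actions revealed by the
  history; thus its \<open>k\<close>-th coordinate is the joint probability of the history and of the current
  state \<open>k\<close>. The function \<open>m\<close> gives the beliefs after the first signal.
\<close>
primrec weighted_belief ::
  "('s \<Rightarrow> real^'k) \<Rightarrow> ('s list \<Rightarrow> 'i pmf) \<Rightarrow> ('s list \<Rightarrow> 'j pmf) \<Rightarrow> 's list \<Rightarrow> real^'k" where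
  "weighted_belief m x y [] = 0"
| "weighted_belief m x y (s # h) = (if h = [] then m s
     else (pmf (x h) (act1 s) * pmf (y h) (act2 s)) *\<^sub>R B s (weighted_belief m x y h))"

text \<open>
  The same recursion without the weights. It does not refer to the strategies, so a player can
  compute it while playing.
\<close>
primrec belief :: "('s \<Rightarrow> real^'k) \<Rightarrow> 's list \<Rightarrow> real^'k" where
  "belief m [] = 0"
| "belief m (s # h) = (if h = [] then m s else B s (belief m h))"

lemma weighted_belief_eq_scaled: "\<exists>w\<ge>0. weighted_belief m x y h = w *\<^sub>R belief m h"
proof (induction h)
  case Nil
  show ?case by (intro exI[of _ 0]) simp
next
  case (Cons s h)
  then obtain w where w: "w \<ge> 0" "weighted_belief m x y h = w *\<^sub>R belief m h" by blast
  show ?case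
  proof (cases "h = []")
    case True
    then show ?thesis by (intro exI[of _ 1]) simp
  next
    case False
    then show ?thesis
      using w
      by (intro exI[of _ "pmf (x h) (act1 s) * pmf (y h) (act2 s) * w"])
         (simp add: linear_scale[OF linear_B])
  qed
qed

text \<open>
  The expected payoff of stage \<open>n\<close>: only absorbed mass pays, and \<open>a\<close> is what was already absorbed
  at the start.
\<close>
primrec absorbed_payoff ::
  "('s \<Rightarrow> real^'k) \<Rightarrow> real \<Rightarrow> ('s list \<Rightarrow> 'i pmf) \<Rightarrow> ('s list \<Rightarrow> 'j pmf) \<Rightarrow> nat \<Rightarrow> real" where
  "absorbed_payoff m a x y 0 = a"
| "absorbed_payoff m a x y (Suc n) = absorbed_payoff m a x y n +
     (\<Sum>h\<in>stage_histories n. mixed_payoff (x h) (y h) (\<lambda>i j. R i j (weighted_belief m x y h)))"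

lemma sum_over_signals:
  fixes F :: "'s \<Rightarrow> real"
  shows "(\<Sum>s\<in>UNIV. G (act1 s) (act2 s) * F s)
    = (\<Sum>i\<in>UNIV. \<Sum>j\<in>UNIV. G i j * (\<Sum>s | act1 s = i \<and> act2 s = j. F s))"
proof -
  have "(\<Sum>s\<in>UNIV. G (act1 s) (act2 s) * F s)
      = (\<Sum>p\<in>UNIV. \<Sum>s | (act1 s, act2 s) = p. G (act1 s) (act2 s) * F s)"
    by (subst sum.group[of UNIV UNIV "\<lambda>s. (act1 s, act2 s)", symmetric]) auto
  also have "\<dots> = (\<Sum>(i, j)\<in>UNIV \<times> UNIV. \<Sum>s | act1 s = i \<and> act2 s = j. G i j * F s)"
    by (intro sum.cong) auto
  finally show ?thesis
    by (simp add: sum.cartesian_product sum_distrib_left)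
qed

lemma sum_weighted_belief_Suc:
  assumes "\<And>a \<mu>. 0 \<le> a \<Longrightarrow> f (a *\<^sub>R \<mu>) = a * f \<mu>"
  shows "(\<Sum>h\<in>stage_histories (Suc n). f (weighted_belief m x y h))
    = (\<Sum>h\<in>stage_histories n. mixed_payoff (x h) (y h)
         (\<lambda>i j. \<Sum>s | act1 s = i \<and> act2 s = j. f (B s (weighted_belief m x y h))))"
proof -
  have "(\<Sum>s\<in>UNIV. f (weighted_belief m x y (s # h)))
      = mixed_payoff (x h) (y h)
         (\<lambda>i j. \<Sum>s | act1 s = i \<and> act2 s = j. f (B s (weighted_belief m x y h)))"
    if "h \<in> stage_histories n" for h
  proof -
    have "h \<noteq> []" using that by (auto simp: stage_histories_def)
    then show ?thesis
      using sum_over_signals[of "\<lambda>i j. pmf (x h) i * pmf (y h) j"]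
      by (simp add: mixed_payoff_def assms)
  qed
  then show ?thesis by (simp add: sum_stage_histories_Suc)
qed

text \<open>
  The absorbed payoff plus the expectation of a homogeneous potential \<open>f\<close> evolves by the
  continuation payoffs of \<open>f\<close>. This turns a one-stage inequality for \<open>f\<close> into a submartingale
  property.
\<close>
lemma absorbed_plus_potential_Suc:
  assumes "\<And>a \<mu>. 0 \<le> a \<Longrightarrow> f (a *\<^sub>R \<mu>) = a * f \<mu>"
  shows "absorbed_payoff m a x y (Suc n) + (\<Sum>h\<in>stage_histories (Suc n). f (weighted_belief m x y h))
    = absorbed_payoff m a x y n
      + (\<Sum>h\<in>stage_histories n. mixed_payoff (x h) (y h) (continuation f (weighted_belief m x y h)))"
  using sum_weighted_belief_Suc[of f, OF assms]
  by (simp add: continuation_def[abs_def] mixed_payoff_add sum.distrib)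

lemma total_mass_bound:
  "\<bar>absorbed_payoff m a x y n\<bar> + (\<Sum>h\<in>stage_histories n. l1 (weighted_belief m x y h))
    \<le> \<bar>a\<bar> + (\<Sum>s\<in>UNIV. l1 (m s))"
proof (induction n)
  case 0
  show ?case by (simp add: sum_stage_histories_0)
next
  case (Suc n)
  let ?wb = "weighted_belief m x y"
  have bal: "\<bar>mixed_payoff (x h) (y h) (\<lambda>i j. R i j (?wb h))\<bar>
      + mixed_payoff (x h) (y h) (\<lambda>i j. \<Sum>s | act1 s = i \<and> act2 s = j. l1 (B s (?wb h)))
      \<le> l1 (?wb h)" for h
  proof -
    have "\<bar>mixed_payoff (x h) (y h) (\<lambda>i j. R i j (?wb h))\<bar>
        \<le> mixed_payoff (x h) (y h) (\<lambda>i j. \<bar>R i j (?wb h)\<bar>)"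
      unfolding mixed_payoff_def
      by (intro order_trans[OF sum_abs] sum_mono) (simp add: abs_mult)
    moreover have "mixed_payoff (x h) (y h) (\<lambda>i j. \<bar>R i j (?wb h)\<bar> +
        (\<Sum>s | act1 s = i \<and> act2 s = j. l1 (B s (?wb h)))) \<le> mixed_payoff (x h) (y h) (\<lambda>i j. l1 (?wb h))"
      by (intro mixed_payoff_mono mass_balance)
    ultimately show ?thesis by (simp add: mixed_payoff_add mixed_payoff_const)
  qed
  have mass_Suc: "(\<Sum>h\<in>stage_histories (Suc n). l1 (?wb h)) = (\<Sum>h\<in>stage_histories n.
      mixed_payoff (x h) (y h) (\<lambda>i j. \<Sum>s | act1 s = i \<and> act2 s = j. l1 (B s (?wb h))))"
    by (rule sum_weighted_belief_Suc) simp
  have "\<bar>absorbed_payoff m a x y (Suc n)\<bar> + (\<Sum>h\<in>stage_histories (Suc n). l1 (?wb h))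
      \<le> \<bar>absorbed_payoff m a x y n\<bar>
        + (\<Sum>h\<in>stage_histories n. \<bar>mixed_payoff (x h) (y h) (\<lambda>i j. R i j (?wb h))\<bar>)
        + (\<Sum>h\<in>stage_histories n. mixed_payoff (x h) (y h)
             (\<lambda>i j. \<Sum>s | act1 s = i \<and> act2 s = j. l1 (B s (?wb h))))"
    unfolding mass_Suc absorbed_payoff.simps
    by (intro add_right_mono order_trans[OF abs_triangle_ineq] add_left_mono sum_abs)
  also have "\<dots> \<le> \<bar>absorbed_payoff m a x y n\<bar> + (\<Sum>h\<in>stage_histories n. l1 (?wb h))"
    unfolding add.assoc sum.distrib[symmetric] by (intro add_left_mono sum_mono bal)
  finally show ?case using Suc.IH by linarith
qed

section \<open>Guaranteeing the vanishing discount limit\<close>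

text \<open>
  The heart of the proof. Write \<open>u\<close> for a discounted value close to \<open>v\<close>. Playing optimally for
  \<open>v\<close> keeps \<open>v\<close> from decreasing in expectation, but where \<open>v\<close> is positive it may go on forever
  without absorption and hence without payoff. Playing optimally for \<open>u\<close> increases \<open>u\<close> at a rate
  proportional to \<open>u\<close>, which forces absorption where \<open>u\<close> is positive but is harmful where \<open>u\<close> is
  negative. The maximum \<open>W\<close> of two potentials built from \<open>v\<close> and \<open>u\<close> combines the advantages: the
  player uses the action that is optimal for the larger one.

  The factor \<open>1 - \<epsilon>\<close> makes \<open>u\<close> the larger one wherever \<open>v\<close> exceeds \<open>\<epsilon>\<close> (per unit of mass); the
  correction \<open>\<delta>\<close> ensures that \<open>u\<close> is nonnegative wherever it is the larger one; and \<open>- \<epsilon> * l1\<close>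
  pays for the error \<open>\<epsilon> * R\<close> that the factor \<open>1 - \<epsilon>\<close> causes at absorption, since absorbed mass
  leaves \<open>l1\<close>. The choice \<open>\<delta> = \<epsilon>\<^sup>2 / 2\<close> makes the error between \<open>u\<close> and \<open>v\<close> smaller than the gain
  \<open>\<epsilon> * v\<close> where \<open>v\<close> exceeds \<open>\<epsilon>\<close>.
\<close>
lemma potential_with_drift:
  assumes v: "vanishing_discount_limit v" and \<epsilon>: "0 < \<epsilon>" "\<epsilon> \<le> 1"
  shows "\<exists>W \<kappa>. 0 < \<kappa> \<and> (\<forall>a\<ge>0. \<forall>\<mu>. W (a *\<^sub>R \<mu>) = a * W \<mu>) \<and>
    (\<forall>\<mu>. v \<mu> - 2 * \<epsilon> * l1 \<mu> \<le> W \<mu>) \<and> (\<forall>\<mu>. W \<mu> \<le> l1 \<mu>) \<and>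
    (\<forall>\<mu>. v \<mu> \<le> \<epsilon> * l1 \<mu> \<longrightarrow> W \<mu> \<le> 2 * \<epsilon> * l1 \<mu>) \<and>
    (\<forall>\<mu>. \<exists>x. \<forall>j. W \<mu> + \<kappa> * (if v \<mu> \<le> \<epsilon> * l1 \<mu> then 0 else l1 \<mu>)
        \<le> (\<Sum>i\<in>UNIV. pmf x i * continuation W \<mu> i j))"
proof -
  define \<delta> where "\<delta> = \<epsilon>\<^sup>2 / 2"
  have \<delta>: "0 < \<delta>" "\<delta> \<le> \<epsilon> / 2" "2 * \<delta> = \<epsilon> * \<epsilon>"
    using \<epsilon> by (auto simp: \<delta>_def power2_eq_square mult_left_le)
  obtain \<eta> u where \<eta>: "0 < \<eta>" "\<eta> < 1" and adm_u: "admissible u"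
    and fixp: "\<And>\<mu>. u \<mu> = (1 - \<eta>) * shapley u \<mu>" and close: "\<And>\<mu>. \<bar>u \<mu> - v \<mu>\<bar> \<le> \<delta> * l1 \<mu>"
    using v \<delta>(1) unfolding vanishing_discount_limit_def by metis
  have adm_v: "admissible v" using v by (simp add: vanishing_discount_limit_def)
  define W where "W \<mu> = max ((1 - \<epsilon>) * v \<mu>) (u \<mu> - \<delta> * l1 \<mu>) - \<epsilon> * l1 \<mu>" for \<mu>
  have "W (a *\<^sub>R \<mu>) = a * W \<mu>" if "0 \<le> a" for a \<mu>
  proof -
    have "W (a *\<^sub>R \<mu>) = max (a * ((1 - \<epsilon>) * v \<mu>)) (a * (u \<mu> - \<delta> * l1 \<mu>)) - a * (\<epsilon> * l1 \<mu>)"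
      using that by (simp add: W_def admissibleD(2)[OF adm_u] admissibleD(2)[OF adm_v] algebra_simps)
    also have "\<dots> = a * W \<mu>"
      using that unfolding W_def right_diff_distrib[of a "max _ _"] by (simp add: max_mult_distrib_left)
    finally show ?thesis .
  qed
  moreover have "v \<mu> - 2 * \<epsilon> * l1 \<mu> \<le> W \<mu>" for \<mu>
  proof -
    have "v \<mu> \<le> l1 \<mu>" using admissibleD(3)[OF adm_v, of \<mu>] by simp
    then have "\<epsilon> * v \<mu> \<le> \<epsilon> * l1 \<mu>" using \<epsilon> by (intro mult_left_mono) auto
    then have "v \<mu> - 2 * \<epsilon> * l1 \<mu> \<le> (1 - \<epsilon>) * v \<mu> - \<epsilon> * l1 \<mu>" by (simp add: algebra_simps)
    also have "\<dots> \<le> W \<mu>" by (simp add: W_def)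
    finally show ?thesis .
  qed
  moreover have "W \<mu> \<le> l1 \<mu>" for \<mu>
  proof -
    have v1: "v \<mu> \<le> l1 \<mu>" using admissibleD(3)[OF adm_v, of \<mu>] by simp
    have "(1 - \<epsilon>) * v \<mu> \<le> (1 - \<epsilon>) * l1 \<mu>" using v1 \<epsilon> by (intro mult_left_mono) auto
    then have "(1 - \<epsilon>) * v \<mu> \<le> l1 \<mu> - \<epsilon> * l1 \<mu>" by (simp add: algebra_simps)
    moreover have "u \<mu> \<le> l1 \<mu>" using admissibleD(3)[OF adm_u, of \<mu>] by simp
    moreover have "0 \<le> \<epsilon> * l1 \<mu>" "0 \<le> \<delta> * l1 \<mu>" using \<epsilon> \<delta> by auto
    ultimately show ?thesis unfolding W_def by linarith
  qed
  moreover have "W \<mu> \<le> 2 * \<epsilon> * l1 \<mu>" if small: "v \<mu> \<le> \<epsilon> * l1 \<mu>" for \<mu>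
  proof -
    have "(1 - \<epsilon>) * v \<mu> \<le> (1 - \<epsilon>) * (\<epsilon> * l1 \<mu>)" using small \<epsilon> by (intro mult_left_mono) auto
    also have "\<dots> \<le> 1 * (\<epsilon> * l1 \<mu>)" using \<epsilon> by (intro mult_right_mono) auto
    finally have "(1 - \<epsilon>) * v \<mu> \<le> \<epsilon> * l1 \<mu>" by simp
    moreover have "u \<mu> - \<delta> * l1 \<mu> \<le> \<epsilon> * l1 \<mu>" using close[of \<mu>] small by linarith
    moreover have "0 \<le> \<epsilon> * l1 \<mu>" using \<epsilon> by simp
    ultimately show ?thesis unfolding W_def by simp
  qed
  moreover have "\<exists>x. \<forall>j. W \<mu> + \<eta> * (\<epsilon> / 2) * (if v \<mu> \<le> \<epsilon> * l1 \<mu> then 0 else l1 \<mu>)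
        \<le> (\<Sum>i\<in>UNIV. pmf x i * continuation W \<mu> i j)" for \<mu>
  proof (cases "(1 - \<epsilon>) * v \<mu> \<le> u \<mu> - \<delta> * l1 \<mu>")
    case True
    (* The potential built from u is the larger one: play optimally in the discounted game. *)
    obtain x where x: "\<And>j. shapley u \<mu> \<le> (\<Sum>i\<in>UNIV. pmf x i * continuation u \<mu> i j)"
      using optimal_mixed1[of "continuation u \<mu>"] by (auto simp: shapley_def)
    have c: "continuation u \<mu> i j - (\<delta> + \<epsilon>) * l1 \<mu> \<le> continuation W \<mu> i j" for i j
    proof -
      let ?S = "{s. act1 s = i \<and> act2 s = j}"
      have "(\<Sum>s\<in>?S. u (B s \<mu>)) - (\<delta> + \<epsilon>) * (\<Sum>s\<in>?S. l1 (B s \<mu>))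
          = (\<Sum>s\<in>?S. u (B s \<mu>) - \<delta> * l1 (B s \<mu>) - \<epsilon> * l1 (B s \<mu>))"
        by (simp add: sum_subtractf sum_distrib_left algebra_simps)
      also have "\<dots> \<le> (\<Sum>s\<in>?S. W (B s \<mu>))" by (intro sum_mono) (simp add: W_def)
      moreover have "(\<delta> + \<epsilon>) * (\<Sum>s\<in>?S. l1 (B s \<mu>)) \<le> (\<delta> + \<epsilon>) * l1 \<mu>"
        using mass_balance[of i j \<mu>] \<epsilon> \<delta> by (intro mult_left_mono) auto
      ultimately show ?thesis unfolding continuation_def by linarith
    qed
    have nonneg: "0 \<le> u \<mu>"
    proof -
      have "(1 - \<epsilon>) * (u \<mu> - \<delta> * l1 \<mu>) \<le> (1 - \<epsilon>) * v \<mu>"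
        using close[of \<mu>] \<epsilon> by (intro mult_left_mono) auto
      then have "\<epsilon> * (\<delta> * l1 \<mu>) \<le> \<epsilon> * u \<mu>" using True by (simp add: algebra_simps)
      then have "\<delta> * l1 \<mu> \<le> u \<mu>" using \<epsilon> by simp
      moreover have "0 \<le> \<delta> * l1 \<mu>" using \<delta> by simp
      ultimately show ?thesis by linarith
    qed
    have shap: "(1 + \<eta>) * u \<mu> \<le> shapley u \<mu>"
    proof -
      have "(1 + \<eta>) * (1 - \<eta>) \<le> 1" by (simp add: algebra_simps)
      moreover have "0 \<le> shapley u \<mu>" using nonneg fixp[of \<mu>] \<eta> by (simp add: zero_le_mult_iff)
      ultimately have "(1 + \<eta>) * (1 - \<eta>) * shapley u \<mu> \<le> 1 * shapley u \<mu>" by (intro mult_right_mono)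
      then show ?thesis using fixp[of \<mu>] by (simp add: mult.assoc)
    qed
    have drift: "\<eta> * (\<epsilon> / 2) * (if v \<mu> \<le> \<epsilon> * l1 \<mu> then 0 else l1 \<mu>) \<le> \<eta> * u \<mu>"
    proof (cases "v \<mu> \<le> \<epsilon> * l1 \<mu>")
      case True
      then show ?thesis using nonneg \<eta> by simp
    next
      case False
      have "\<delta> * l1 \<mu> \<le> \<epsilon> / 2 * l1 \<mu>" using \<delta> by (intro mult_right_mono) auto
      then have "\<epsilon> / 2 * l1 \<mu> \<le> u \<mu>" using False close[of \<mu>] by linarith
      then show ?thesis using False \<eta> by (simp add: mult.assoc)
    qed
    have "W \<mu> + \<eta> * (\<epsilon> / 2) * (if v \<mu> \<le> \<epsilon> * l1 \<mu> then 0 else l1 \<mu>)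
        \<le> (\<Sum>i\<in>UNIV. pmf x i * continuation W \<mu> i j)" for j
    proof -
      have "W \<mu> = u \<mu> - (\<delta> + \<epsilon>) * l1 \<mu>" using True by (simp add: W_def algebra_simps)
      then have "W \<mu> + \<eta> * (\<epsilon> / 2) * (if v \<mu> \<le> \<epsilon> * l1 \<mu> then 0 else l1 \<mu>)
          \<le> (1 + \<eta>) * u \<mu> - (\<delta> + \<epsilon>) * l1 \<mu>"
        using drift by (simp only: distrib_right)
      also have "\<dots> \<le> (\<Sum>i\<in>UNIV. pmf x i * continuation u \<mu> i j) - (\<delta> + \<epsilon>) * l1 \<mu>"
        using shap x[of j] by linarith
      also have "\<dots> = (\<Sum>i\<in>UNIV. pmf x i * (continuation u \<mu> i j - (\<delta> + \<epsilon>) * l1 \<mu>))"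
        by (simp add: right_diff_distrib sum_subtractf sum_pmf_finite flip: sum_distrib_right)
      also have "\<dots> \<le> (\<Sum>i\<in>UNIV. pmf x i * continuation W \<mu> i j)"
        by (intro sum_mono mult_left_mono c) auto
      finally show ?thesis .
    qed
    then show ?thesis by blast
  next
    case False
    have small: "v \<mu> \<le> \<epsilon> * l1 \<mu>"
    proof (rule ccontr)
      assume "\<not> ?thesis"
      then have "\<epsilon> * (\<epsilon> * l1 \<mu>) \<le> \<epsilon> * v \<mu>" using \<epsilon> by (intro mult_left_mono) auto
      then have "2 * (\<delta> * l1 \<mu>) \<le> \<epsilon> * v \<mu>" using \<delta>(3) by (simp flip: mult.assoc)
      then have "(1 - \<epsilon>) * v \<mu> \<le> v \<mu> - 2 * (\<delta> * l1 \<mu>)" by (simp add: algebra_simps)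
      then show False using False close[of \<mu>] by linarith
    qed
    (* Play optimally for v, which is a fixed point of the undiscounted operator. *)
    obtain x where x: "\<And>j. shapley v \<mu> \<le> (\<Sum>i\<in>UNIV. pmf x i * continuation v \<mu> i j)"
      using optimal_mixed1[of "continuation v \<mu>"] by (auto simp: shapley_def)
    have c: "(1 - \<epsilon>) * continuation v \<mu> i j - \<epsilon> * l1 \<mu> \<le> continuation W \<mu> i j" for i j
    proof -
      let ?S = "{s. act1 s = i \<and> act2 s = j}"
      have "(1 - \<epsilon>) * (\<Sum>s\<in>?S. v (B s \<mu>)) - \<epsilon> * (\<Sum>s\<in>?S. l1 (B s \<mu>))
          = (\<Sum>s\<in>?S. (1 - \<epsilon>) * v (B s \<mu>) - \<epsilon> * l1 (B s \<mu>))"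
        by (simp add: sum_subtractf sum_distrib_left)
      also have "\<dots> \<le> (\<Sum>s\<in>?S. W (B s \<mu>))" by (intro sum_mono) (simp add: W_def)
      moreover have "\<epsilon> * (- R i j \<mu> + (\<Sum>s\<in>?S. l1 (B s \<mu>))) \<le> \<epsilon> * l1 \<mu>"
        using mass_balance[of i j \<mu>] \<epsilon> by (intro mult_left_mono) auto
      ultimately show ?thesis
        unfolding continuation_def by (simp add: algebra_simps)
    qed
    have "W \<mu> \<le> (\<Sum>i\<in>UNIV. pmf x i * continuation W \<mu> i j)" for j
    proof -
      have "W \<mu> = (1 - \<epsilon>) * shapley v \<mu> - \<epsilon> * l1 \<mu>"
        using False by (simp add: W_def vanishing_discount_limit_fixpoint[OF v])
      also have "\<dots> \<le> (1 - \<epsilon>) * (\<Sum>i\<in>UNIV. pmf x i * continuation v \<mu> i j) - \<epsilon> * l1 \<mu>"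
        using x[of j] \<epsilon> by (intro diff_right_mono mult_left_mono) auto
      also have "\<dots> = (\<Sum>i\<in>UNIV. pmf x i * ((1 - \<epsilon>) * continuation v \<mu> i j - \<epsilon> * l1 \<mu>))"
      proof -
        have "(\<Sum>i\<in>UNIV. pmf x i * (\<epsilon> * l1 \<mu>)) = \<epsilon> * l1 \<mu>"
          by (simp add: sum_pmf_finite flip: sum_distrib_right)
        then show ?thesis
          by (simp add: right_diff_distrib sum_subtractf sum_distrib_left mult.left_commute)
      qed
      also have "\<dots> \<le> (\<Sum>i\<in>UNIV. pmf x i * continuation W \<mu> i j)"
        by (intro sum_mono mult_left_mono c) auto
      finally show ?thesis .
    qed
    then show ?thesis using small by auto
  qed
  moreover have "0 < \<eta> * (\<epsilon> / 2)" using \<eta> \<epsilon> by simp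
  ultimately show ?thesis by blast
qed

text \<open>
  The absorbed payoff plus the expected potential \<open>W\<close> is a submartingale bounded by 1 and starting
  at least at -3. Its drift is proportional to the unabsorbed mass \<open>bad\<close> at beliefs where \<open>v\<close> exceeds
  \<open>\<epsilon>\<close>, so the total of \<open>bad\<close> over all stages is at most \<open>4 / \<kappa>\<close>, whatever player 2 does. At all
  other beliefs \<open>W\<close> is at most \<open>2 * \<epsilon>\<close> per unit of mass. So the absorbed payoff of a stage falls
  short of the initial potential by at most \<open>2 * \<epsilon>\<close> plus the value of \<open>bad\<close> at that stage, and the
  latter vanishes in the average.
\<close>
lemma uniform_guarantee:
  assumes v: "vanishing_discount_limit v" and mass: "\<bar>a\<bar> + (\<Sum>s\<in>UNIV. l1 (m s)) \<le> 1"
    and e: "0 < e"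
  shows "\<exists>x. \<exists>n0\<ge>1. \<forall>n\<ge>n0. \<forall>y.
    a + (\<Sum>s\<in>UNIV. v (m s)) - e \<le> (1 / real n) * (\<Sum>t<n. absorbed_payoff m a x y t)"
proof -
  define \<epsilon> where "\<epsilon> = min 1 (e / 5)"
  have \<epsilon>: "0 < \<epsilon>" "\<epsilon> \<le> 1" "5 * \<epsilon> \<le> e" using e by (auto simp: \<epsilon>_def)
  define bad where "bad \<mu> = (if v \<mu> \<le> \<epsilon> * l1 \<mu> then 0 else l1 \<mu>)" for \<mu>
  obtain W \<kappa> where W: "0 < \<kappa>" "\<forall>a\<ge>0. \<forall>\<mu>. W (a *\<^sub>R \<mu>) = a * W \<mu>"
    "\<forall>\<mu>. v \<mu> - 2 * \<epsilon> * l1 \<mu> \<le> W \<mu>" "\<forall>\<mu>. W \<mu> \<le> l1 \<mu>"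
    "\<forall>\<mu>. v \<mu> \<le> \<epsilon> * l1 \<mu> \<longrightarrow> W \<mu> \<le> 2 * \<epsilon> * l1 \<mu>"
    "\<forall>\<mu>. \<exists>x. \<forall>j. W \<mu> + \<kappa> * (if v \<mu> \<le> \<epsilon> * l1 \<mu> then 0 else l1 \<mu>)
        \<le> (\<Sum>i\<in>UNIV. pmf x i * continuation W \<mu> i j)"
    using potential_with_drift[OF v \<epsilon>(1,2)] by (elim exE conjE) rule
  note \<kappa> = W(1) and W_hom = W(2)[rule_format] and W_ge = W(3)[rule_format]
    and W_le = W(4)[rule_format] and W_small = W(5)[rule_format]
  obtain X where X: "\<And>\<mu> j. W \<mu> + \<kappa> * bad \<mu> \<le> (\<Sum>i\<in>UNIV. pmf (X \<mu>) i * continuation W \<mu> i j)"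
    using choice[OF W(6)] unfolding bad_def by blast
  have adm_v: "admissible v" using v by (simp add: vanishing_discount_limit_def)
  have bad_hom: "bad (c *\<^sub>R \<mu>) = c * bad \<mu>" if "0 \<le> c" for c \<mu>
  proof (cases "c = 0")
    case True
    then show ?thesis by (simp add: bad_def)
  next
    case False
    have "v (c *\<^sub>R \<mu>) \<le> \<epsilon> * l1 (c *\<^sub>R \<mu>) \<longleftrightarrow> c * v \<mu> \<le> c * (\<epsilon> * l1 \<mu>)"
      using that admissibleD(2)[OF adm_v] by (simp add: mult_ac)
    then have "v (c *\<^sub>R \<mu>) \<le> \<epsilon> * l1 (c *\<^sub>R \<mu>) \<longleftrightarrow> v \<mu> \<le> \<epsilon> * l1 \<mu>"
      using that False by simp
    then show ?thesis using that unfolding bad_def by simp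
  qed
  define x where "x h = X (belief m h)" for h
  define n0 where "n0 = nat \<lceil>4 / (\<kappa> * \<epsilon>)\<rceil> + 1"
  have "a + (\<Sum>s\<in>UNIV. v (m s)) - e \<le> (1 / real n) * (\<Sum>t<n. absorbed_payoff m a x y t)"
    if n: "n \<ge> n0" for n y
  proof -
    let ?wb = "weighted_belief m x y"
    let ?A = "absorbed_payoff m a x y"
    let ?D = "\<lambda>f t. \<Sum>h\<in>stage_histories t. f (?wb h)"
    define U where "U t = ?A t + ?D W t" for t
    have step: "W (?wb h) + \<kappa> * bad (?wb h) \<le> mixed_payoff (x h) (y h) (continuation W (?wb h))" for h
    proof -
      obtain w where w: "0 \<le> w" "?wb h = w *\<^sub>R belief m h"
        using weighted_belief_eq_scaled by blast
      have "W (?wb h) + \<kappa> * bad (?wb h) = w * (W (belief m h) + \<kappa> * bad (belief m h))"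
        using w by (simp add: W_hom bad_hom algebra_simps)
      also have "\<dots> \<le> (\<Sum>i\<in>UNIV. pmf (x h) i * continuation W (?wb h) i j)" for j
      proof -
        have "(\<Sum>i\<in>UNIV. pmf (x h) i * continuation W (?wb h) i j)
            = w * (\<Sum>i\<in>UNIV. pmf (x h) i * continuation W (belief m h) i j)"
          using w by (simp add: continuation_scale[OF W_hom] sum_distrib_left mult.left_commute)
        then show ?thesis using X[of "belief m h" j] w by (simp add: x_def mult_left_mono)
      qed
      finally show ?thesis by (rule le_mixed_payoff)
    qed
    have U_Suc: "U t + \<kappa> * ?D bad t \<le> U (Suc t)" for t
    proof -
      have "?D W t + \<kappa> * ?D bad t \<le> (\<Sum>h\<in>stage_histories t. mixed_payoff (x h) (y h) (continuation W (?wb h)))"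
        unfolding sum_distrib_left sum.distrib[symmetric] by (intro sum_mono step)
      then show ?thesis
        using absorbed_plus_potential_Suc[of W m a x y t, OF W_hom] unfolding U_def by linarith
    qed
    have U_sum: "U 0 + \<kappa> * (\<Sum>t<N. ?D bad t) \<le> U N" for N
    proof (induction N)
      case (Suc N)
      then show ?case using U_Suc[of N] by (simp add: distrib_left)
    qed simp
    have mass_le: "\<bar>?A t\<bar> + ?D l1 t \<le> 1" for t
      using total_mass_bound[of m a x y t] mass by linarith
    have U_le: "U t \<le> 1" for t
    proof -
      have "?D W t \<le> ?D l1 t" by (intro sum_mono W_le)
      then show ?thesis using mass_le[of t] by (simp add: U_def)
    qed
    have U0: "a + (\<Sum>s\<in>UNIV. v (m s)) - 2 * \<epsilon> \<le> U 0"
    proof -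
      have "(\<Sum>s\<in>UNIV. v (m s)) - 2 * \<epsilon> * (\<Sum>s\<in>UNIV. l1 (m s)) \<le> (\<Sum>s\<in>UNIV. W (m s))"
        unfolding sum_distrib_left sum_subtractf[symmetric] by (intro sum_mono W_ge)
      moreover have "2 * \<epsilon> * (\<Sum>s\<in>UNIV. l1 (m s)) \<le> 2 * \<epsilon> * 1"
        using mass \<epsilon> by (intro mult_left_mono) auto
      ultimately show ?thesis by (simp add: U_def sum_stage_histories_0)
    qed
    have U0_ge: "- 3 \<le> U 0"
    proof -
      have "- (\<Sum>s\<in>UNIV. l1 (m s)) \<le> (\<Sum>s\<in>UNIV. v (m s))"
        unfolding sum_negf[symmetric] using admissibleD(3)[OF adm_v]
        by (intro sum_mono) (simp add: abs_le_iff minus_le_iff)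
      then show ?thesis using U0 mass \<epsilon> by linarith
    qed
    have bad_total: "(\<Sum>t<N. ?D bad t) \<le> 4 / \<kappa>" for N
      using U_sum[of N] U_le[of N] U0_ge \<kappa> by (simp add: field_simps)
    have A_ge: "U 0 - 2 * \<epsilon> - ?D bad t \<le> ?A t" for t
    proof -
      have W_split: "W \<mu> \<le> 2 * \<epsilon> * l1 \<mu> + bad \<mu>" for \<mu>
        using W_small[of \<mu>] W_le[of \<mu>] \<epsilon> by (auto simp: bad_def intro: add_increasing)
      have "?D W t \<le> 2 * \<epsilon> * ?D l1 t + ?D bad t"
        unfolding sum_distrib_left sum.distrib[symmetric] by (intro sum_mono W_split)
      moreover have "2 * \<epsilon> * ?D l1 t \<le> 2 * \<epsilon> * 1"
        using mass_le[of t] \<epsilon> by (intro mult_left_mono) auto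
      moreover have "U 0 \<le> U t"
      proof -
        have "0 \<le> \<kappa> * (\<Sum>t<t. ?D bad t)"
          using \<kappa> by (intro mult_nonneg_nonneg sum_nonneg) (auto simp: bad_def)
        then show ?thesis using U_sum[of t] by linarith
      qed
      ultimately show ?thesis by (simp add: U_def)
    qed
    have n_pos: "0 < n" using n by (simp add: n0_def)
    have "real n * (U 0 - 2 * \<epsilon>) - 4 / \<kappa> \<le> (\<Sum>t<n. U 0 - 2 * \<epsilon> - ?D bad t)"
      using bad_total[of n] by (simp add: sum_subtractf)
    also have "\<dots> \<le> (\<Sum>t<n. ?A t)" by (intro sum_mono A_ge)
    finally have total: "real n * (U 0 - 2 * \<epsilon>) - 4 / \<kappa> \<le> (\<Sum>t<n. ?A t)" .
    have "4 / (\<kappa> * \<epsilon>) \<le> real n"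
      using n unfolding n0_def by linarith
    then have "4 / \<kappa> \<le> real n * \<epsilon>"
      using \<kappa> \<epsilon> n_pos by (simp add: field_simps)
    then have "real n * (U 0 - 3 * \<epsilon>) \<le> (\<Sum>t<n. ?A t)"
      using total by (simp add: algebra_simps)
    then have "U 0 - 3 * \<epsilon> \<le> (1 / real n) * (\<Sum>t<n. ?A t)"
      using n_pos by (simp add: field_simps)
    then show ?thesis using U0 \<epsilon> by linarith
  qed
  moreover have "n0 \<ge> 1" by (simp add: n0_def)
  ultimately show ?thesis by blast
qed

end

lemma mixed_payoff_swap: "mixed_payoff p r M = mixed_payoff r p (\<lambda>j i. M i j)"
  unfolding mixed_payoff_def by (subst sum.swap) (simp add: mult_ac)

lemma mixed_payoff_neg: "mixed_payoff p r (\<lambda>i j. - M i j) = - mixed_payoff p r M"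
  by (simp add: mixed_payoff_def sum_negf)

lemma absorbed_payoff_swap:
  assumes "belief_game B R act1 act2"
  shows "belief_game.absorbed_payoff B (\<lambda>j i \<mu>. - R i j \<mu>) act2 act1 m (- a) y x n
    = - belief_game.absorbed_payoff B R act1 act2 m a x y n"
proof -
  interpret G: belief_game B R act1 act2 by fact
  interpret S: belief_game B "\<lambda>j i \<mu>. - R i j \<mu>" act2 act1
    using assms(1) by (rule belief_game_swap)
  have "S.weighted_belief m y x h = G.weighted_belief m x y h" for h
    by (induction h) (auto simp: mult.commute)
  then show ?thesis
    by (induction n)
       (simp_all add: mixed_payoff_neg sum_negf mixed_payoff_swap[of "y _"])
qed

section \<open>Reduction of symmetric recursive games to belief games\<close>
lemma expectation_bind_finite:
  fixes p :: "'a::finite pmf" and f :: "'a \<Rightarrow> 'b pmf" and F :: "'b \<Rightarrow> real"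
  assumes "\<And>a. finite (set_pmf (f a))"
  shows "measure_pmf.expectation (p \<bind> f) F = (\<Sum>a\<in>UNIV. pmf p a * measure_pmf.expectation (f a) F)"
  using assms by (subst pmf_expectation_bind[where A = UNIV]) auto

lemma finite_set_play:
  fixes q :: "('k::finite, 'i::finite, 'j::finite, 'c::finite, 'd::finite) transition"
  shows "finite (set_pmf (play q p \<sigma> \<tau> n))"
  by (induction n) (auto simp: split_beta)

lemma expectation_play_Suc:
  fixes q :: "('k::finite, 'i::finite, 'j::finite, 'c::finite, 'd::finite) transition"
    and F :: "('k \<times> 'c \<times> 'd \<times> 'i \<times> 'j) list \<times> ('k \<times> 'c \<times> 'd) \<Rightarrow> real"
  shows "measure_pmf.expectation (play q p \<sigma> \<tau> (Suc n)) F =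
    measure_pmf.expectation (play q p \<sigma> \<tau> n) (\<lambda>(h, (k, c, d)).
      mixed_payoff (\<sigma> (map (\<lambda>(k, c, d, i, j). (c, i)) h) c) (\<tau> (map (\<lambda>(k, c, d, i, j). (d, j)) h) d)
        (\<lambda>i j. \<Sum>s\<in>UNIV. pmf (q k i j) s * F (h @ [(k, c, d, i, j)], s)))"
proof -
  let ?P = "play q p \<sigma> \<tau> n"
  let ?f = "\<lambda>(h, (k, c, d)). \<sigma> (map (\<lambda>(k, c, d, i, j). (c, i)) h) c \<bind>
    (\<lambda>i. \<tau> (map (\<lambda>(k, c, d, i, j). (d, j)) h) d \<bind>
    (\<lambda>j. q k i j \<bind> (\<lambda>s. return_pmf (h @ [(k, c, d, i, j)], s))))"
  have fin: "finite (set_pmf (?f hs))" for hs by (simp add: split_beta)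
  have "measure_pmf.expectation (play q p \<sigma> \<tau> (Suc n)) F
      = (\<Sum>hs\<in>set_pmf ?P. pmf ?P hs *\<^sub>R measure_pmf.expectation (?f hs) F)"
    unfolding play.simps by (rule pmf_expectation_bind) (use fin finite_set_play in auto)
  also have "\<dots> = measure_pmf.expectation ?P (\<lambda>hs. measure_pmf.expectation (?f hs) F)"
    by (rule integral_measure_pmf[symmetric]) (auto intro: finite_set_play)
  also have "(\<lambda>hs. measure_pmf.expectation (?f hs) F) = (\<lambda>(h, (k, c, d)).
      mixed_payoff (\<sigma> (map (\<lambda>(k, c, d, i, j). (c, i)) h) c) (\<tau> (map (\<lambda>(k, c, d, i, j). (d, j)) h) d)
        (\<lambda>i j. \<Sum>s\<in>UNIV. pmf (q k i j) s * F (h @ [(k, c, d, i, j)], s)))"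
    by (intro ext)
       (simp add: split_beta expectation_bind_finite mixed_payoff_def sum_distrib_left mult.assoc)
  finally show ?thesis .
qed

text \<open>
  Recursive games with symmetric signals in a form convenient for proofs: the stage payoff is a
  function \<open>r\<close> of the state alone, and all conditions on signals are put on the support of the
  transitions.
\<close>
locale symmetric_recursive_game =
  fixes g :: "('k::finite, 'i::finite, 'j::finite) payoff"
    and q :: "('k, 'i, 'j, 'c::finite, 'd::finite) transition"
    and dhat :: "'c \<Rightarrow> 'd" and chat :: "'d \<Rightarrow> 'c"
    and ihat :: "'c \<Rightarrow> 'i" and jhat :: "'d \<Rightarrow> 'j"
    and Kstar :: "'k set" and r :: "'k \<Rightarrow> real"
  assumes signals: "(k', c, d) \<in> set_pmf (q k i j) \<Longrightarrow> ihat c = i \<and> jhat d = j \<and> dhat c = d \<and> chat d = c"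
    and absorbing: "k \<in> Kstar \<Longrightarrow> (k', s) \<in> set_pmf (q k i j) \<Longrightarrow> k' = k"
    and payoff: "g k i j = r k"
    and payoff_transient: "k \<notin> Kstar \<Longrightarrow> r k = 0"
    and payoff_bound: "\<bar>r k\<bar> \<le> 1"
begin

text \<open>
  The signal determines both actions, so the transition that produced it is known and Bayes' rule
  without normalisation is linear. Mass that reaches an absorbing state is dropped, although
  the players may not observe absorption: what they do afterwards has no influence on the payoff.
\<close>
definition belief_update :: "'c \<times> 'd \<Rightarrow> real^'k \<Rightarrow> real^'k" where
  "belief_update s \<mu> = (\<chi> k'. if k' \<in> Kstar then 0
     else \<Sum>k\<in>- Kstar. \<mu> $ k * pmf (q k (ihat (fst s)) (jhat (snd s))) (k', s))"

definition absorption :: "'i \<Rightarrow> 'j \<Rightarrow> real^'k \<Rightarrow> real" where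
  "absorption i j \<mu> = (\<Sum>k\<in>- Kstar. \<mu> $ k * (\<Sum>t\<in>UNIV. pmf (q k i j) t * r (fst t)))"

lemma sum_state_signal:
  fixes f :: "'k \<times> 'c \<times> 'd \<Rightarrow> real"
  shows "(\<Sum>t\<in>UNIV. f t) = (\<Sum>k\<in>UNIV. \<Sum>s\<in>UNIV. f (k, s))"
  by (simp add: sum.cartesian_product)

lemma belief_game: "belief_game belief_update absorption (\<lambda>s. ihat (fst s)) (\<lambda>s. jhat (snd s))"
proof (rule belief_game.intro)
  fix s and i j and \<mu> :: "real^'k"
  show "linear (belief_update s)"
    by (rule linearI)
       (auto simp: belief_update_def vec_eq_iff algebra_simps sum.distrib sum_distrib_left)
  show "linear (absorption i j)"
    by (rule linearI)
       (auto simp: absorption_def algebra_simps sum.distrib simp flip: sum_distrib_left)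
  let ?S = "{s. ihat (fst s) = i \<and> jhat (snd s) = j}"
  have R: "\<bar>absorption i j \<mu>\<bar> \<le> (\<Sum>k\<in>- Kstar. \<bar>\<mu> $ k\<bar> * (\<Sum>k'\<in>Kstar. \<Sum>s\<in>UNIV. pmf (q k i j) (k', s)))"
  proof -
    have "\<bar>\<Sum>t\<in>UNIV. pmf (q k i j) t * r (fst t)\<bar> \<le> (\<Sum>k'\<in>Kstar. \<Sum>s\<in>UNIV. pmf (q k i j) (k', s))" for k
    proof -
      have "\<bar>\<Sum>t\<in>UNIV. pmf (q k i j) t * r (fst t)\<bar> \<le> (\<Sum>t\<in>UNIV. pmf (q k i j) t * \<bar>r (fst t)\<bar>)"
        by (rule order_trans[OF sum_abs]) (simp add: abs_mult)
      also have "\<dots> = (\<Sum>k'\<in>UNIV. \<Sum>s\<in>UNIV. pmf (q k i j) (k', s) * \<bar>r k'\<bar>)"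
        by (simp add: sum_state_signal)
      also have "\<dots> = (\<Sum>k'\<in>Kstar. \<Sum>s\<in>UNIV. pmf (q k i j) (k', s) * \<bar>r k'\<bar>)"
        by (rule sum.mono_neutral_right) (auto simp: payoff_transient)
      also have "\<dots> \<le> (\<Sum>k'\<in>Kstar. \<Sum>s\<in>UNIV. pmf (q k i j) (k', s))"
        by (intro sum_mono mult_left_le payoff_bound) auto
      finally show ?thesis .
    qed
    then show ?thesis unfolding absorption_def
      by (intro order_trans[OF sum_abs] sum_mono) (simp add: abs_mult mult_left_mono)
  qed
  have B: "(\<Sum>s\<in>?S. l1 (belief_update s \<mu>))
      \<le> (\<Sum>k\<in>- Kstar. \<bar>\<mu> $ k\<bar> * (\<Sum>k'\<in>- Kstar. \<Sum>s\<in>UNIV. pmf (q k i j) (k', s)))"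
  proof -
    have "l1 (belief_update s \<mu>) \<le> (\<Sum>k'\<in>- Kstar. \<Sum>k\<in>- Kstar. \<bar>\<mu> $ k\<bar> * pmf (q k i j) (k', s))"
      if "s \<in> ?S" for s
    proof -
      have "l1 (belief_update s \<mu>)
          = (\<Sum>k'\<in>UNIV. if k' \<in> Kstar then 0 else \<bar>\<Sum>k\<in>- Kstar. \<mu> $ k * pmf (q k i j) (k', s)\<bar>)"
        unfolding l1_def belief_update_def using that by (intro sum.cong) auto
      also have "\<dots> = (\<Sum>k'\<in>- Kstar. \<bar>\<Sum>k\<in>- Kstar. \<mu> $ k * pmf (q k i j) (k', s)\<bar>)"
        by (rule sum.mono_neutral_cong_right) auto
      also have "\<dots> \<le> (\<Sum>k'\<in>- Kstar. \<Sum>k\<in>- Kstar. \<bar>\<mu> $ k\<bar> * pmf (q k i j) (k', s))"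
        by (intro sum_mono order_trans[OF sum_abs]) (simp add: abs_mult)
      finally show ?thesis .
    qed
    then have "(\<Sum>s\<in>?S. l1 (belief_update s \<mu>))
        \<le> (\<Sum>s\<in>?S. \<Sum>k'\<in>- Kstar. \<Sum>k\<in>- Kstar. \<bar>\<mu> $ k\<bar> * pmf (q k i j) (k', s))"
      by (rule sum_mono)
    also have "\<dots> \<le> (\<Sum>s\<in>UNIV. \<Sum>k'\<in>- Kstar. \<Sum>k\<in>- Kstar. \<bar>\<mu> $ k\<bar> * pmf (q k i j) (k', s))"
      by (rule sum_mono2) (auto intro!: sum_nonneg)
    also have "\<dots> = (\<Sum>k'\<in>- Kstar. \<Sum>s\<in>UNIV. \<Sum>k\<in>- Kstar. \<bar>\<mu> $ k\<bar> * pmf (q k i j) (k', s))"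
      by (rule sum.swap)
    also have "\<dots> = (\<Sum>k'\<in>- Kstar. \<Sum>k\<in>- Kstar. \<Sum>s\<in>UNIV. \<bar>\<mu> $ k\<bar> * pmf (q k i j) (k', s))"
      by (intro sum.cong sum.swap refl)
    also have "\<dots> = (\<Sum>k\<in>- Kstar. \<Sum>k'\<in>- Kstar. \<Sum>s\<in>UNIV. \<bar>\<mu> $ k\<bar> * pmf (q k i j) (k', s))"
      by (rule sum.swap)
    finally show ?thesis by (simp add: sum_distrib_left)
  qed
  have "\<bar>absorption i j \<mu>\<bar> + (\<Sum>s\<in>?S. l1 (belief_update s \<mu>))
      \<le> (\<Sum>k\<in>- Kstar. \<bar>\<mu> $ k\<bar> * ((\<Sum>k'\<in>Kstar. \<Sum>s\<in>UNIV. pmf (q k i j) (k', s))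
           + (\<Sum>k'\<in>- Kstar. \<Sum>s\<in>UNIV. pmf (q k i j) (k', s))))"
    using R B by (simp add: distrib_left sum.distrib)
  also have "\<dots> = (\<Sum>k\<in>- Kstar. \<bar>\<mu> $ k\<bar>)"
  proof -
    have "(\<Sum>k'\<in>Kstar. \<Sum>s\<in>UNIV. pmf (q k i j) (k', s)) + (\<Sum>k'\<in>- Kstar. \<Sum>s\<in>UNIV. pmf (q k i j) (k', s)) = 1" for k
    proof -
      have "(\<Sum>k'\<in>Kstar. \<Sum>s\<in>UNIV. pmf (q k i j) (k', s)) + (\<Sum>k'\<in>- Kstar. \<Sum>s\<in>UNIV. pmf (q k i j) (k', s))
        = (\<Sum>k'\<in>Kstar \<union> - Kstar. \<Sum>s\<in>UNIV. pmf (q k i j) (k', s))"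
        by (rule sum.union_disjoint[symmetric]) auto
      also have "\<dots> = (\<Sum>t\<in>UNIV. pmf (q k i j) t)"
        by (simp add: sum_state_signal Compl_partition)
      finally show ?thesis by (simp only: sum_pmf_finite)
    qed
    then show ?thesis by simp
  qed
  also have "\<dots> \<le> l1 \<mu>"
    unfolding l1_def by (rule sum_mono2) auto
  finally show "\<bar>absorption i j \<mu>\<bar> + (\<Sum>s\<in>?S. l1 (belief_update s \<mu>)) \<le> l1 \<mu>" .
qed

sublocale belief_game belief_update absorption "\<lambda>s. ihat (fst s)" "\<lambda>s. jhat (snd s)"
  by (rule belief_game)

definition initial_belief :: "('k \<times> 'c \<times> 'd) pmf \<Rightarrow> 'c \<times> 'd \<Rightarrow> real^'k" where
  "initial_belief p s = (\<chi> k. if k \<in> Kstar then 0 else pmf p (k, s))"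

definition initial_absorption :: "('k \<times> 'c \<times> 'd) pmf \<Rightarrow> real" where
  "initial_absorption p = (\<Sum>t\<in>UNIV. pmf p t * r (fst t))"

lemma initial_mass: "\<bar>initial_absorption p\<bar> + (\<Sum>s\<in>UNIV. l1 (initial_belief p s)) \<le> 1"
proof -
  have "\<bar>initial_absorption p\<bar> \<le> (\<Sum>t\<in>UNIV. pmf p t * \<bar>r (fst t)\<bar>)"
    unfolding initial_absorption_def by (rule order_trans[OF sum_abs]) (simp add: abs_mult)
  also have "\<dots> \<le> (\<Sum>t\<in>UNIV. pmf p t * (if fst t \<in> Kstar then 1 else 0))"
    by (intro sum_mono mult_left_mono) (auto simp: payoff_transient payoff_bound)
  finally have 1: "\<bar>initial_absorption p\<bar> \<le> (\<Sum>t\<in>UNIV. pmf p t * (if fst t \<in> Kstar then 1 else 0))" .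
  have "(\<Sum>s\<in>UNIV. l1 (initial_belief p s))
      = (\<Sum>s\<in>UNIV. \<Sum>k\<in>UNIV. pmf p (k, s) * (if k \<in> Kstar then 0 else 1))"
    unfolding l1_def initial_belief_def by (intro sum.cong) auto
  also have "\<dots> = (\<Sum>t\<in>UNIV. pmf p t * (if fst t \<in> Kstar then 0 else 1))"
    unfolding sum_state_signal by (subst sum.swap) simp
  finally have "\<bar>initial_absorption p\<bar> + (\<Sum>s\<in>UNIV. l1 (initial_belief p s))
      \<le> (\<Sum>t\<in>UNIV. pmf p t * (if fst t \<in> Kstar then 1 else 0) + pmf p t * (if fst t \<in> Kstar then 0 else 1))"
    using 1 by (simp only: sum.distrib)
  also have "\<dots> = (\<Sum>t\<in>UNIV. pmf p t)" by (intro sum.cong) auto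
  finally show ?thesis by (simp only: sum_pmf_finite)
qed

text \<open>
  The private histories of the two players, oldest entry first, that belong to a public history:
  the action taken at a stage is read off the signal that follows.
\<close>
primrec history1 :: "('c \<times> 'd) list \<Rightarrow> ('c \<times> 'i) list" where
  "history1 [] = []"
| "history1 (s # ss) = (if ss = [] then [] else history1 ss @ [(fst (hd ss), ihat (fst s))])"

primrec history2 :: "('c \<times> 'd) list \<Rightarrow> ('d \<times> 'j) list" where
  "history2 [] = []"
| "history2 (s # ss) = (if ss = [] then [] else history2 ss @ [(snd (hd ss), jhat (snd s))])"

definition consistent :: "('c \<times> 'd) list \<Rightarrow> bool" where
  "consistent ss \<longleftrightarrow> ss \<noteq> [] \<and> (\<forall>(c, d)\<in>set ss. dhat c = d \<and> chat d = c)"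

text \<open>
  A strategy that depends on the public history is realised as a behavior strategy by
  reconstructing the opponent's signals from one's own.
\<close>
definition strategy1 :: "(('c \<times> 'd) list \<Rightarrow> 'i pmf) \<Rightarrow> ('c, 'i) strategy" where
  "strategy1 x h c = x (rev (map (\<lambda>c. (c, dhat c)) (map fst h @ [c])))"

definition strategy2 :: "(('c \<times> 'd) list \<Rightarrow> 'j pmf) \<Rightarrow> ('d, 'j) strategy" where
  "strategy2 y h d = y (rev (map (\<lambda>d. (chat d, d)) (map fst h @ [d])))"

lemma signals_of_history:
  assumes "ss \<noteq> []"
  shows "map fst (history1 ss) @ [fst (hd ss)] = rev (map fst ss)"
    and "map fst (history2 ss) @ [snd (hd ss)] = rev (map snd ss)"
proof -
  have "map fst (history1 ss) @ [fst (hd ss)] = rev (map fst ss) \<and>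
        map fst (history2 ss) @ [snd (hd ss)] = rev (map snd ss)"
    using assms by (induction ss) auto
  then show "map fst (history1 ss) @ [fst (hd ss)] = rev (map fst ss)"
    "map fst (history2 ss) @ [snd (hd ss)] = rev (map snd ss)" by auto
qed

lemma strategy_of_public:
  assumes "consistent ss"
  shows "strategy1 x (history1 ss) (fst (hd ss)) = x ss"
    and "strategy2 y (history2 ss) (snd (hd ss)) = y ss"
proof -
  have ne: "ss \<noteq> []" using assms by (simp add: consistent_def)
  have "map (\<lambda>s. (fst s, dhat (fst s))) ss = ss" "map (\<lambda>s. (chat (snd s), snd s)) ss = ss"
    using assms by (auto simp: consistent_def intro!: map_idI)
  then show "strategy1 x (history1 ss) (fst (hd ss)) = x ss"
    "strategy2 y (history2 ss) (snd (hd ss)) = y ss"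
    unfolding strategy1_def strategy2_def signals_of_history[OF ne]
    by (simp_all add: rev_map o_def)
qed

definition public_history :: "('k \<times> 'c \<times> 'd \<times> 'i \<times> 'j) list \<Rightarrow> 'c \<times> 'd \<Rightarrow> ('c \<times> 'd) list" where
  "public_history h s = s # rev (map (\<lambda>(k, c, d, i, j). (c, d)) h)"

lemma public_of_play:
  assumes "\<And>k c d. (k, c, d) \<in> set_pmf p \<Longrightarrow> dhat c = d \<and> chat d = c"
    and "(h, (k, c, d)) \<in> set_pmf (play q p \<sigma> \<tau> n)"
  shows "consistent (public_history h (c, d)) \<and>
    history1 (public_history h (c, d)) = map (\<lambda>(k, c, d, i, j). (c, i)) h \<and>
    history2 (public_history h (c, d)) = map (\<lambda>(k, c, d, i, j). (d, j)) h"
  using assms(2)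
proof (induction n arbitrary: h k c d)
  case 0
  then show ?case using assms(1) by (auto simp: public_history_def consistent_def)
next
  case (Suc n)
  from Suc.prems obtain h0 k0 c0 d0 i j where
    prev: "(h0, (k0, c0, d0)) \<in> set_pmf (play q p \<sigma> \<tau> n)"
    and new: "(k, c, d) \<in> set_pmf (q k0 i j)" and h: "h = h0 @ [(k0, c0, d0, i, j)]"
    by (auto simp: set_bind_pmf split_beta)
  have "public_history h (c, d) = (c, d) # public_history h0 (c0, d0)" by (simp add: public_history_def h)
  moreover have "hd (public_history h0 (c0, d0)) = (c0, d0)" "public_history h0 (c0, d0) \<noteq> []"
    by (simp_all add: public_history_def)
  ultimately show ?case
    using Suc.IH[OF prev] signals[OF new] by (auto simp: consistent_def h)
qed

text \<open>
  On consistent histories, which are the only ones that occur, behavior strategies \<open>\<sigma>\<close> and \<open>\<tau>\<close>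
  coincide with functions \<open>x\<close> and \<open>y\<close> of the public history.
\<close>
context
  fixes p :: "('k \<times> 'c \<times> 'd) pmf" and \<sigma> :: "('c, 'i) strategy" and \<tau> :: "('d, 'j) strategy"
    and x :: "('c \<times> 'd) list \<Rightarrow> 'i pmf" and y :: "('c \<times> 'd) list \<Rightarrow> 'j pmf"
  assumes p: "\<And>k c d. (k, c, d) \<in> set_pmf p \<Longrightarrow> dhat c = d \<and> chat d = c"
    and x: "\<And>ss. consistent ss \<Longrightarrow> \<sigma> (history1 ss) (fst (hd ss)) = x ss"
    and y: "\<And>ss. consistent ss \<Longrightarrow> \<tau> (history2 ss) (snd (hd ss)) = y ss"
begin

abbreviation "wb \<equiv> weighted_belief (initial_belief p) x y"

definition public_expectation :: "nat \<Rightarrow> (('c \<times> 'd) list \<Rightarrow> 'k \<Rightarrow> real) \<Rightarrow> real" where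
  "public_expectation n F =
     measure_pmf.expectation (play q p \<sigma> \<tau> n) (\<lambda>(h, (k, s)). F (public_history h s) k)"

lemma play_mixed_actions:
  assumes "(h, (k, c, d)) \<in> set_pmf (play q p \<sigma> \<tau> n)"
  shows "\<sigma> (map (\<lambda>(k, c, d, i, j). (c, i)) h) c = x (public_history h (c, d))"
    and "\<tau> (map (\<lambda>(k, c, d, i, j). (d, j)) h) d = y (public_history h (c, d))"
  using public_of_play[OF p assms] x[of "public_history h (c, d)"] y[of "public_history h (c, d)"]
  by (auto simp: public_history_def)

lemma expectation_play_cong:
  assumes "\<And>h k c d. (h, (k, c, d)) \<in> set_pmf (play q p \<sigma> \<tau> n) \<Longrightarrow> F (h, (k, c, d)) = G (h, (k, c, d))"
  shows "measure_pmf.expectation (play q p \<sigma> \<tau> n) F = (measure_pmf.expectation (play q p \<sigma> \<tau> n) G :: real)"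
  by (rule integral_cong_AE) (use assms in \<open>auto simp: AE_measure_pmf_iff\<close>)

lemma public_expectation_Suc:
  "public_expectation (Suc n) F = public_expectation n (\<lambda>ss k. mixed_payoff (x ss) (y ss)
     (\<lambda>i j. \<Sum>t\<in>UNIV. pmf (q k i j) t * F (snd t # ss) (fst t)))"
  unfolding public_expectation_def expectation_play_Suc
  by (rule expectation_play_cong)
     (auto simp: play_mixed_actions split_beta public_history_def)

lemma public_expectation_diff:
  "public_expectation n F - public_expectation n G = public_expectation n (\<lambda>ss k. F ss k - G ss k)"
  unfolding public_expectation_def
  by (subst Bochner_Integration.integral_diff[symmetric])
     (auto intro!: integrable_measure_pmf_finite finite_set_play Bochner_Integration.integral_cong)

lemma weighted_belief_absorbed:
  assumes "k \<in> Kstar"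
  shows "wb ss $ k = 0"
  using assms by (cases ss) (auto simp: initial_belief_def belief_update_def)

lemma mixed_payoff_single_signal:
  "mixed_payoff \<xi> \<zeta> (\<lambda>i j. pmf (q k i j) (k', s)) =
     pmf \<xi> (ihat (fst s)) * pmf \<zeta> (jhat (snd s)) * pmf (q k (ihat (fst s)) (jhat (snd s))) (k', s)"
proof -
  have zero: "pmf (q k i j) (k', s) = 0" if "i \<noteq> ihat (fst s) \<or> j \<noteq> jhat (snd s)" for i j
    using that signals[of k' "fst s" "snd s" k i j] by (auto simp: set_pmf_iff)
  have "mixed_payoff \<xi> \<zeta> (\<lambda>i j. pmf (q k i j) (k', s))
      = (\<Sum>i\<in>UNIV. if i = ihat (fst s) then \<Sum>j\<in>UNIV. pmf \<xi> i * pmf \<zeta> j * pmf (q k i j) (k', s) else 0)"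
    unfolding mixed_payoff_def by (intro sum.cong refl) (auto simp: zero)
  also have "\<dots> = (\<Sum>j\<in>UNIV. pmf \<xi> (ihat (fst s)) * pmf \<zeta> j * pmf (q k (ihat (fst s)) j) (k', s))"
    by simp
  also have "\<dots> = (\<Sum>j\<in>UNIV. if j = jhat (snd s)
      then pmf \<xi> (ihat (fst s)) * pmf \<zeta> j * pmf (q k (ihat (fst s)) j) (k', s) else 0)"
    by (intro sum.cong refl) (auto simp: zero)
  finally show ?thesis by simp
qed

lemma mixed_payoff_sum: "mixed_payoff \<xi> \<zeta> (\<lambda>i j. \<Sum>t\<in>A. M t i j) = (\<Sum>t\<in>A. mixed_payoff \<xi> \<zeta> (M t))"
proof -
  have "mixed_payoff \<xi> \<zeta> (\<lambda>i j. \<Sum>t\<in>A. M t i j)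
      = (\<Sum>i\<in>UNIV. \<Sum>t\<in>A. \<Sum>j\<in>UNIV. pmf \<xi> i * pmf \<zeta> j * M t i j)"
    unfolding mixed_payoff_def sum_distrib_left by (intro sum.cong refl sum.swap)
  also have "\<dots> = (\<Sum>t\<in>A. mixed_payoff \<xi> \<zeta> (M t))"
    unfolding mixed_payoff_def by (rule sum.swap)
  finally show ?thesis .
qed

lemma mixed_payoff_scale: "mixed_payoff \<xi> \<zeta> (\<lambda>i j. M i j * c) = mixed_payoff \<xi> \<zeta> M * c"
  by (simp add: mixed_payoff_def sum_distrib_right mult.assoc)

text \<open>
  This identifies \<open>weighted_belief\<close> as the joint law of public history and state, on the
  states that are not absorbing. Weighted beliefs carry no mass elsewhere, so the test functions
  \<open>F\<close> have to vanish at absorbing states.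
\<close>
lemma public_expectation_transient:
  assumes "\<And>ss k. k \<in> Kstar \<Longrightarrow> F ss k = 0"
  shows "public_expectation n F = (\<Sum>ss\<in>stage_histories n. \<Sum>k\<in>UNIV. wb ss $ k * F ss k)"
  using assms
proof (induction n arbitrary: F)
  case 0
  have "public_expectation 0 F = (\<Sum>t\<in>UNIV. pmf p t * F [snd t] (fst t))"
    unfolding public_expectation_def
    by (simp add: integral_measure_pmf[where A = UNIV] split_beta public_history_def)
  also have "\<dots> = (\<Sum>s\<in>UNIV. \<Sum>k\<in>UNIV. pmf p (k, s) * F [s] k)"
    unfolding sum_state_signal by (subst sum.swap) simp
  also have "\<dots> = (\<Sum>s\<in>UNIV. \<Sum>k\<in>UNIV. wb [s] $ k * F [s] k)"
    using 0 by (intro sum.cong refl) (auto simp: initial_belief_def)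
  finally show ?case by (simp add: sum_stage_histories_0)
next
  case (Suc n)
  define G where "G = (\<lambda>ss k. mixed_payoff (x ss) (y ss)
     (\<lambda>i j. \<Sum>t\<in>UNIV. pmf (q k i j) t * F (snd t # ss) (fst t)))"
  have "G ss k = 0" if k: "k \<in> Kstar" for ss k
  proof -
    have "pmf (q k i j) t * F (snd t # ss) (fst t) = 0" for i j t
      using absorbing[OF k, of "fst t" "snd t" i j] Suc.prems[OF k] by (auto simp: set_pmf_iff)
    then have "(\<Sum>t\<in>UNIV. pmf (q k i j) t * F (snd t # ss) (fst t)) = 0" for i j
      by (intro sum.neutral ballI)
    then show ?thesis by (simp only: G_def mixed_payoff_const)
  qed
  then have "public_expectation n G = (\<Sum>ss\<in>stage_histories n. \<Sum>k\<in>UNIV. wb ss $ k * G ss k)"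
    by (rule Suc.IH)
  moreover have "public_expectation (Suc n) F = public_expectation n G"
    unfolding public_expectation_Suc G_def ..
  moreover
  have "(\<Sum>k\<in>UNIV. wb ss $ k * G ss k) = (\<Sum>s\<in>UNIV. \<Sum>k\<in>UNIV. wb (s # ss) $ k * F (s # ss) k)"
    if "ss \<in> stage_histories n" for ss
  proof -
    have ne: "ss \<noteq> []" using that by (auto simp: stage_histories_def)
    let ?P = "\<lambda>k k' s. pmf (x ss) (ihat (fst s)) * pmf (y ss) (jhat (snd s))
        * pmf (q k (ihat (fst s)) (jhat (snd s))) (k', s)"
    have G: "G ss k = (\<Sum>s\<in>UNIV. \<Sum>k'\<in>UNIV. ?P k k' s * F (s # ss) k')" for k
      unfolding G_def mixed_payoff_sum mixed_payoff_scale sum_state_signal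
      by (subst sum.swap) (simp add: mixed_payoff_single_signal)
    have "(\<Sum>k\<in>UNIV. wb ss $ k * G ss k) = (\<Sum>k\<in>- Kstar. wb ss $ k * G ss k)"
      by (rule sum.mono_neutral_right) (auto simp: weighted_belief_absorbed)
    also have "\<dots> = (\<Sum>k\<in>- Kstar. \<Sum>s\<in>UNIV. \<Sum>k'\<in>UNIV. wb ss $ k * ?P k k' s * F (s # ss) k')"
      by (simp add: G sum_distrib_left mult.assoc)
    also have "\<dots> = (\<Sum>s\<in>UNIV. \<Sum>k\<in>- Kstar. \<Sum>k'\<in>UNIV. wb ss $ k * ?P k k' s * F (s # ss) k')"
      by (rule sum.swap)
    also have "\<dots> = (\<Sum>s\<in>UNIV. \<Sum>k'\<in>UNIV. \<Sum>k\<in>- Kstar. wb ss $ k * ?P k k' s * F (s # ss) k')"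
      by (intro sum.cong refl sum.swap)
    also have "\<dots> = (\<Sum>s\<in>UNIV. \<Sum>k'\<in>UNIV. wb (s # ss) $ k' * F (s # ss) k')"
    proof (intro sum.cong refl)
      fix s k'
      show "(\<Sum>k\<in>- Kstar. wb ss $ k * ?P k k' s * F (s # ss) k') = wb (s # ss) $ k' * F (s # ss) k'"
      proof (cases "k' \<in> Kstar")
        case True
        then show ?thesis using Suc.prems by simp
      next
        case False
        then show ?thesis
          using ne by (simp add: belief_update_def sum_distrib_right sum_distrib_left mult_ac)
      qed
    qed
    finally show ?thesis .
  qed
  then have "(\<Sum>ss\<in>stage_histories n. \<Sum>k\<in>UNIV. wb ss $ k * G ss k)
      = (\<Sum>ss\<in>stage_histories (Suc n). \<Sum>k\<in>UNIV. wb ss $ k * F ss k)"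
    unfolding sum_stage_histories_Suc by (rule sum.cong[OF refl])
  ultimately show ?case by (simp only:)
qed

text \<open>
  The expected payoff changes from a stage to the next only through mass that is absorbed in
  between; the difference of the two integrands vanishes at absorbing states, so its expectation
  is given by the weighted beliefs.
\<close>
lemma public_expectation_payoff:
  "public_expectation n (\<lambda>ss k. r k) = absorbed_payoff (initial_belief p) (initial_absorption p) x y n"
proof (induction n)
  case 0
  show ?case
    unfolding public_expectation_def
    by (simp add: integral_measure_pmf[where A = UNIV] split_beta initial_absorption_def)
next
  case (Suc n)
  define G where "G = (\<lambda>ss k. mixed_payoff (x ss) (y ss) (\<lambda>i j. \<Sum>t\<in>UNIV. pmf (q k i j) t * r (fst t)))"
  have G: "G ss k - r k = 0" if k: "k \<in> Kstar" for ss k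
  proof -
    have "(\<Sum>t\<in>UNIV. pmf (q k i j) t * r (fst t)) = r k" for i j
    proof -
      have "(\<Sum>t\<in>UNIV. pmf (q k i j) t * r (fst t)) = (\<Sum>t\<in>UNIV. pmf (q k i j) t * r k)"
      proof (intro sum.cong refl)
        fix t
        show "pmf (q k i j) t * r (fst t) = pmf (q k i j) t * r k"
          using absorbing[OF k, of "fst t" "snd t" i j] by (auto simp: set_pmf_iff)
      qed
      then show ?thesis by (simp add: sum_pmf_finite flip: sum_distrib_right)
    qed
    then show ?thesis by (simp add: G_def mixed_payoff_const)
  qed
  have "public_expectation (Suc n) (\<lambda>ss k. r k) - public_expectation n (\<lambda>ss k. r k)
      = public_expectation n (\<lambda>ss k. G ss k - r k)"
    unfolding public_expectation_Suc G_def by (rule public_expectation_diff)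
  also have "\<dots> = (\<Sum>ss\<in>stage_histories n. \<Sum>k\<in>UNIV. wb ss $ k * (G ss k - r k))"
    by (rule public_expectation_transient) (rule G)
  also have "\<dots> = (\<Sum>ss\<in>stage_histories n. mixed_payoff (x ss) (y ss) (\<lambda>i j. absorption i j (wb ss)))"
  proof (intro sum.cong refl)
    fix ss
    have "(\<Sum>k\<in>UNIV. wb ss $ k * (G ss k - r k)) = (\<Sum>k\<in>- Kstar. G ss k * wb ss $ k)"
      by (rule sum.mono_neutral_cong_right)
         (auto simp: weighted_belief_absorbed payoff_transient)
    also have "\<dots> = mixed_payoff (x ss) (y ss) (\<lambda>i j. absorption i j (wb ss))"
      by (simp add: G_def absorption_def mult.commute[of "wb ss $ _"] mixed_payoff_sum mixed_payoff_scale)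
    finally show "(\<Sum>k\<in>UNIV. wb ss $ k * (G ss k - r k))
        = mixed_payoff (x ss) (y ss) (\<lambda>i j. absorption i j (wb ss))" .
  qed
  finally show ?case using Suc.IH by simp
qed

lemma mean_payoff_eq:
  "mean_payoff g q n p \<sigma> \<tau> =
     (1 / real n) * (\<Sum>t<n. absorbed_payoff (initial_belief p) (initial_absorption p) x y t)"
proof -
  let ?total = "\<lambda>h :: ('k \<times> 'c \<times> 'd \<times> 'i \<times> 'j) list. \<Sum>(k, c, d, i, j)\<leftarrow>h. r k"
  have "measure_pmf.expectation (play q p \<sigma> \<tau> n) (\<lambda>(h, s). ?total h)
      = (\<Sum>t<n. public_expectation t (\<lambda>ss k. r k))"
  proof (induction n)
    case 0
    show ?case by (simp add: split_beta)
  next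
    case (Suc n)
    have "measure_pmf.expectation (play q p \<sigma> \<tau> (Suc n)) (\<lambda>(h, s). ?total h)
        = measure_pmf.expectation (play q p \<sigma> \<tau> n) (\<lambda>(h, (k, s)). ?total h + r k)"
      unfolding expectation_play_Suc
      by (rule expectation_play_cong)
         (simp add: mixed_payoff_const sum_pmf_finite flip: sum_distrib_right)
    also have "\<dots> = measure_pmf.expectation (play q p \<sigma> \<tau> n) (\<lambda>(h, s). ?total h)
        + public_expectation n (\<lambda>ss k. r k)"
      unfolding public_expectation_def
      by (subst Bochner_Integration.integral_add[symmetric])
         (auto intro!: integrable_measure_pmf_finite finite_set_play Bochner_Integration.integral_cong)
    finally show ?case using Suc.IH by (simp only: sum.lessThan_Suc)
  qed
  then show ?thesis
    by (simp add: mean_payoff_def payoff case_prod_unfold public_expectation_payoff)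
qed

end

section \<open>Existence of the uniform value\<close>

text \<open>
  Both players guarantee the same quantity \<open>V\<close>. A player who guarantees \<open>V\<close> a fortiori defends
  it, so \<open>V\<close> is at the same time the uniform maxmin and the uniform minmax.
\<close>
lemma uniform_value:
  assumes p: "\<And>k c d. (k, c, d) \<in> set_pmf p \<Longrightarrow> dhat c = d \<and> chat d = c"
  shows "has_uniform_value g q p"
proof -
  obtain v where v: "vanishing_discount_limit v" using vanishing_discount_limit_exists by blast
  let ?m = "initial_belief p" and ?a = "initial_absorption p"
  define V where "V = ?a + (\<Sum>s\<in>UNIV. v (?m s))"
  have guarantee1: "\<exists>\<sigma>. \<exists>n0\<ge>1. \<forall>n\<ge>n0. \<forall>\<tau>. V - e \<le> mean_payoff g q n p \<sigma> \<tau>" if e: "0 < e" for e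
  proof -
    obtain x n0 where n0: "n0 \<ge> 1" and x: "\<And>n y. n \<ge> n0 \<Longrightarrow>
        V - e \<le> (1 / real n) * (\<Sum>t<n. absorbed_payoff ?m ?a x y t)"
      using uniform_guarantee[OF v initial_mass e, of p] unfolding V_def by blast
    have "V - e \<le> mean_payoff g q n p (strategy1 x) \<tau>" if "n \<ge> n0" for n \<tau>
      using x[OF that] mean_payoff_eq[of p "strategy1 x" x \<tau> "\<lambda>ss. \<tau> (history2 ss) (snd (hd ss))" n]
      by (simp add: p strategy_of_public)
    with n0 show ?thesis by blast
  qed
  have guarantee2: "\<exists>\<tau>. \<exists>n0\<ge>1. \<forall>n\<ge>n0. \<forall>\<sigma>. mean_payoff g q n p \<sigma> \<tau> \<le> V + e" if e: "0 < e" for e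
  proof -
    interpret S: belief_game belief_update "\<lambda>j i \<mu>. - absorption i j \<mu>" "\<lambda>s. jhat (snd s)" "\<lambda>s. ihat (fst s)"
      by (rule belief_game_swap[OF belief_game])
    have "\<bar>- ?a\<bar> + (\<Sum>s\<in>UNIV. l1 (?m s)) \<le> 1" using initial_mass[of p] by simp
    from S.uniform_guarantee[OF vanishing_discount_limit_swap[OF belief_game v] this e]
    obtain y n0 where n0: "n0 \<ge> 1" and y: "\<And>n x. n \<ge> n0 \<Longrightarrow>
        - ?a + (\<Sum>s\<in>UNIV. - v (?m s)) - e \<le> (1 / real n) * (\<Sum>t<n. S.absorbed_payoff ?m (- ?a) y x t)"
      by blast
    have "mean_payoff g q n p \<sigma> (strategy2 y) \<le> V + e" if "n \<ge> n0" for n \<sigma>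
      using y[OF that, of "\<lambda>ss. \<sigma> (history1 ss) (fst (hd ss))"]
        mean_payoff_eq[of p \<sigma> "\<lambda>ss. \<sigma> (history1 ss) (fst (hd ss))" "strategy2 y" y n]
      by (simp add: p strategy_of_public absorbed_payoff_swap[OF belief_game] sum_negf V_def)
    with n0 show ?thesis by blast
  qed
  have "is_uniform_maxmin g q p V"
    unfolding is_uniform_maxmin_def
  proof (intro conjI allI impI)
    fix e :: real assume e: "0 < e"
    show "\<exists>\<sigma>. \<exists>n0\<ge>1. \<forall>n\<ge>n0. \<forall>\<tau>. V - e \<le> mean_payoff g q n p \<sigma> \<tau>"
      by (rule guarantee1[OF e])
    obtain \<tau> n0 where "n0 \<ge> 1" "\<forall>n\<ge>n0. \<forall>\<sigma>. mean_payoff g q n p \<sigma> \<tau> \<le> V + e"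
      using guarantee2[OF e] by (elim exE conjE) rule
    then show "\<exists>n0\<ge>1. \<exists>\<tau>. \<forall>n\<ge>n0. mean_payoff g q n p \<sigma> \<tau> \<le> V + e" for \<sigma>
      by (intro exI[of _ n0] conjI exI[of _ \<tau>]) simp_all
  qed
  moreover have "is_uniform_minmax g q p V"
    unfolding is_uniform_minmax_def
  proof (intro conjI allI impI)
    fix e :: real assume e: "0 < e"
    show "\<exists>\<tau>. \<exists>n0\<ge>1. \<forall>n\<ge>n0. \<forall>\<sigma>. mean_payoff g q n p \<sigma> \<tau> \<le> V + e"
      by (rule guarantee2[OF e])
    obtain \<sigma> n0 where "n0 \<ge> 1" "\<forall>n\<ge>n0. \<forall>\<tau>. V - e \<le> mean_payoff g q n p \<sigma> \<tau>"
      using guarantee1[OF e] by (elim exE conjE) rule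
    then show "\<exists>n0\<ge>1. \<exists>\<sigma>. \<forall>n\<ge>n0. V - e \<le> mean_payoff g q n p \<sigma> \<tau>" for \<tau>
      by (intro exI[of _ n0] conjI exI[of _ \<sigma>]) simp_all
  qed
  ultimately show ?thesis unfolding has_uniform_value_def by blast
qed

end

lemma prob_1_iff: "measure_pmf.prob p A = 1 \<longleftrightarrow> set_pmf p \<subseteq> A"
  by (subst measure_pmf.prob_eq_1) (auto simp: AE_measure_pmf_iff)

theorem corollary5p9:
  fixes g :: "('k::finite, 'i::finite, 'j::finite) payoff"
    and q :: "('k, 'i, 'j, 'c::finite, 'd::finite) transition"
    and dhat :: "'c \<Rightarrow> 'd" and chat :: "'d \<Rightarrow> 'c"
  assumes "recursive_game g q"
    and "symmetric_signals q dhat chat"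
  shows "\<forall>p \<in> symmetric_initial dhat chat. has_uniform_value g q p"
proof
  fix p :: "('k \<times> 'c \<times> 'd) pmf" assume p: "p \<in> symmetric_initial dhat chat"
  have bound: "\<And>k i j. g k i j \<in> {-1..1}"
    using assms(1) unfolding recursive_game_def repeated_game_def by simp
  have "\<exists>ihat jhat. \<forall>k i j k' c d. pmf (q k i j) (k', c, d) > 0 \<longrightarrow> ihat c = i \<and> jhat d = j"
    using assms(1) unfolding recursive_game_def repeated_game_def by blast
  then obtain ihat jhat where
    actions: "\<And>k i j k' c d. pmf (q k i j) (k', c, d) > 0 \<Longrightarrow> ihat c = i \<and> jhat d = j"
    by metis
  obtain K0 Kstar where partition: "K0 \<union> Kstar = UNIV" "K0 \<inter> Kstar = {}"
    and transient': "\<forall>k\<in>K0. \<forall>i j. g k i j = 0"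
    and absorbing': "\<forall>k\<in>Kstar. \<forall>i j. (\<Sum>c\<in>UNIV. \<Sum>d\<in>UNIV. pmf (q k i j) (k, c, d)) = 1"
    and const': "\<forall>k\<in>Kstar. \<forall>i j i' j'. g k i j = g k i' j'"
    using assms(1) unfolding recursive_game_def by (elim conjE exE) rule
  note transient = transient'[rule_format] and absorbing = absorbing'[rule_format]
    and const = const'[rule_format]
  define r where "r k = g k undefined undefined" for k
  have "symmetric_recursive_game g q dhat chat ihat jhat Kstar r"
  proof
    fix k k' c d i j
    assume "(k', c, d) \<in> set_pmf (q k i j)"
    then show "ihat c = i \<and> jhat d = j \<and> dhat c = d \<and> chat d = c"
      using assms(2) actions[of k i j k' c d]
      by (force simp: symmetric_signals_def player1_more_informed_def player2_more_informed_def
          prob_1_iff event_E_def event_E'_def pmf_positive)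
  next
    fix k k' s i j
    assume k: "k \<in> Kstar" and s: "(k', s) \<in> set_pmf (q k i j)"
    have "measure_pmf.prob (q k i j) ({k} \<times> UNIV) = (\<Sum>t\<in>{k} \<times> UNIV. pmf (q k i j) t)"
      by (rule measure_measure_pmf_finite) simp
    also have "\<dots> = (\<Sum>c\<in>UNIV. \<Sum>d\<in>UNIV. pmf (q k i j) (k, c, d))"
    proof -
      have "{k} \<times> (UNIV :: ('c \<times> 'd) set) = Pair k ` UNIV" by auto
      then show ?thesis by (simp add: sum.reindex inj_on_def sum.cartesian_product)
    qed
    also have "\<dots> = 1" by (rule absorbing[OF k])
    finally show "k' = k" using s by (auto simp: prob_1_iff)
  next
    fix k i j
    show "g k i j = r k"
      using transient const partition by (cases "k \<in> K0") (auto simp: r_def)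
    show "\<bar>r k\<bar> \<le> 1" using bound[of k undefined undefined] by (auto simp: r_def)
  next
    fix k assume "k \<notin> Kstar"
    then have "k \<in> K0" using partition by blast
    then show "r k = 0" by (simp add: r_def transient)
  qed
  then show "has_uniform_value g q p"
    by (rule symmetric_recursive_game.uniform_value)
       (use p in \<open>auto simp: symmetric_initial_def prob_1_iff event_E_def event_E'_def\<close>)
qed

end
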